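(* Let $G$ be a simple graph with vertex set $[n]$. The map $\Psi_G:\mathfrak{S}_n\to L_G$ is a lattice quotient map if and only if $G$ is filled.
   Context: Write $[n]=\{1,\dots,n\}$. For a simple graph $G$ on $[n]$ and $I\subseteq[n]$, $G|_I$ is the induced subgraph. A tube of $G$ is a nonempty $I\subseteq[n]$ with $G|_I$ connected. Tubes $I,J$ are compatible if $I\subseteq J$, or $J\subseteq I$, or $I\cup J$ is not a tube. A tubing is a set of pairwise compatible tubes; a maximal tubing is one maximal under inclusion; $\mathrm{MTub}(G)$ is the set of maximal tubings. If $\mathcal{X}$ is a maximal tubing, each tube $I\in\mathcal{X}$ contains a unique element $\mathrm{top}_{\mathcal{X}}(I)$ not contained in any tube of $\mathcal{X}$ properly contained in $I$. The poset $L_G$: if $\mathcal{X},\mathcal{Y}$ are maximal tubings with $\mathcal{Y}=(\mathcal{X}\setminus\{I\})\cup\{J\}$ for distinct tubes $I,J$, write $\mathcal{X}\to\mathcal{Y}$ if $\mathrm{top}_{\mathcal{X}}(I)<\mathrm{top}_{\mathcal{Y}}(J)$. $L_G$ is the set $\mathrm{MTub}(G)$ partially ordered by the reflexive transitive closure of $\to$. The symmetric group $\mathfrak{S}_n$ (permutations in one-line notation $w=w_1\cdots w_n$) carries the weak order: $x\le y$ iff $\mathrm{inv}(x)\subseteq\mathrm{inv}(y)$, where $(i,k)$ with $i<k$ is in $\mathrm{inv}(x)$ iff $k$ precedes $i$ in $x_1\cdots x_n$. This is a lattice. The map $\Psi_G:\mathfrak{S}_n\to L_G$ sends $w$ to $\{X_1,\dots,X_n\}$,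 where $X_j$ is the vertex set of the connected component of $G|_{\{w_1,\dots,w_j\}}$ containing $w_j$; it is surjective. A map $\phi:L\to L'$ is a lattice quotient map if $L,L'$ are lattices and $\phi$ is surjective and preserves binary meets and joins. (So "$\Psi_G$ is a lattice quotient map" includes that $L_G$ is a lattice.) $G$ is filled if whenever $\{i,k\}$ is an edge of $G$ and $i<j<k$, both $\{i,j\}$ and $\{j,k\}$ are edges of $G$. *)

theory Defs
  imports "HOL-Algebra.Lattice" "HOL-Combinatorics.Multiset_Permutations"
begin

text \<open>A simple graph on \<open>[n] = {1..n}\<close> is given by its set \<open>E\<close> of edges, each edge being a
  two-element subset of \<open>{1..n}\<close>.\<close>

definition simple_graph :: "nat \<Rightarrow> nat set set \<Rightarrow> bool" where
  "simple_graph n E \<longleftrightarrow> (\<forall>e\<in>E. e \<subseteq> {1..n} \<and> card e = 2)"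

definition filled :: "nat set set \<Rightarrow> bool" where
  "filled E \<longleftrightarrow> (\<forall>i j k. {i, k} \<in> E \<and> i < j \<and> j < k \<longrightarrow> {i, j} \<in> E \<and> {j, k} \<in> E)"

definition induced_adj :: "nat set set \<Rightarrow> nat set \<Rightarrow> nat rel" where
  "induced_adj E I = {(x, y). x \<in> I \<and> y \<in> I \<and> {x, y} \<in> E}"

definition component :: "nat set set \<Rightarrow> nat set \<Rightarrow> nat \<Rightarrow> nat set" where
  "component E I x = {y \<in> I. (x, y) \<in> (induced_adj E I)\<^sup>*}"

definition tube :: "nat \<Rightarrow> nat set set \<Rightarrow> nat set \<Rightarrow> bool" where
  "tube n E I \<longleftrightarrow> I \<noteq> {} \<and> I \<subseteq> {1..n} \<and> (\<forall>x\<in>I. \<forall>y\<in>I. (x, y) \<in> (induced_adj E I)\<^sup>*)"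

definition compatible :: "nat \<Rightarrow> nat set set \<Rightarrow> nat set \<Rightarrow> nat set \<Rightarrow> bool" where
  "compatible n E I J \<longleftrightarrow> I \<subseteq> J \<or> J \<subseteq> I \<or> \<not> tube n E (I \<union> J)"

definition tubing :: "nat \<Rightarrow> nat set set \<Rightarrow> nat set set \<Rightarrow> bool" where
  "tubing n E \<X> \<longleftrightarrow> (\<forall>I\<in>\<X>. tube n E I) \<and> (\<forall>I\<in>\<X>. \<forall>J\<in>\<X>. compatible n E I J)"

definition MTub :: "nat \<Rightarrow> nat set set \<Rightarrow> nat set set set" where
  "MTub n E = {\<X>. tubing n E \<X> \<and> (\<forall>\<Y>. tubing n E \<Y> \<and> \<X> \<subseteq> \<Y> \<longrightarrow> \<Y> = \<X>)}"

text \<open>Meaningful only if \<open>\<X>\<close> is a maximal tubing and \<open>I \<in> \<X>\<close>.\<close>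

definition tube_top :: "nat set set \<Rightarrow> nat set \<Rightarrow> nat" where
  "tube_top \<X> I = (THE x. x \<in> I \<and> (\<forall>J\<in>\<X>. J \<subset> I \<longrightarrow> x \<notin> J))"

text \<open>The condition \<open>I \<in> \<X>\<close> is implicit in the usual formulation, where \<open>tube_top \<X> I\<close> has to be
  defined; \<open>J \<in> \<Y>\<close> then holds automatically.\<close>

definition flip :: "nat \<Rightarrow> nat set set \<Rightarrow> nat set set rel" where
  "flip n E = {(\<X>, \<Y>). \<X> \<in> MTub n E \<and> \<Y> \<in> MTub n E \<and>
     (\<exists>I J. tube n E I \<and> tube n E J \<and> I \<noteq> J \<and> I \<in> \<X> \<and> \<Y> = (\<X> - {I}) \<union> {J} \<and>
        tube_top \<X> I < tube_top \<Y> J)}"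

definition tubing_poset :: "nat \<Rightarrow> nat set set \<Rightarrow> nat set set gorder" where
  "tubing_poset n E =
     \<lparr>carrier = MTub n E, eq = (=), le = (\<lambda>\<X> \<Y>. (\<X>, \<Y>) \<in> (flip n E)\<^sup>*)\<rparr>"

text \<open>Permutations of \<open>{1..n}\<close> are lists in one-line notation; list positions count from \<open>0\<close>.\<close>

definition inversions :: "nat list \<Rightarrow> (nat \<times> nat) set" where
  "inversions w = {(i, k). i < k \<and> (\<exists>p q. p < q \<and> q < length w \<and> w ! p = k \<and> w ! q = i)}"

definition weak_order :: "nat \<Rightarrow> nat list gorder" where
  "weak_order n =
     \<lparr>carrier = permutations_of_set {1..n}, eq = (=), le = (\<lambda>x y. inversions x \<subseteq> inversions y)\<rparr>"

definition Psi :: "nat set set \<Rightarrow> nat list \<Rightarrow> nat set set" where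
  "Psi E w = (\<lambda>j. component E (set (take j w)) (w ! (j - 1))) ` {1..length w}"

definition lattice_quotient_map ::
    "('a, 'c) gorder_scheme \<Rightarrow> ('b, 'd) gorder_scheme \<Rightarrow> ('a \<Rightarrow> 'b) \<Rightarrow> bool" where
  "lattice_quotient_map L L' \<phi> \<longleftrightarrow>
     lattice L \<and> lattice L' \<and> \<phi> ` carrier L = carrier L' \<and>
     (\<forall>x\<in>carrier L. \<forall>y\<in>carrier L.
        \<phi> (x \<sqinter>\<^bsub>L\<^esub> y) = \<phi> x \<sqinter>\<^bsub>L'\<^esub> \<phi> y \<and> \<phi> (x \<squnion>\<^bsub>L\<^esub> y) = \<phi> x \<squnion>\<^bsub>L'\<^esub> \<phi> y)"

end

theory Submission
  imports Defs
begin

text \<open>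
  A maximal tubing \<open>\<X>\<close> partially orders the vertices by inclusion of the tubes with a given top, and
  \<open>Psi\<close> maps precisely the linear extensions of this order to \<open>\<X>\<close>.

  If the graph is filled, then each fibre of \<open>Psi\<close> is an interval of the weak order: the pairs
  \<open>i < k\<close> with \<open>k\<close> below \<open>i\<close> are the inversions of its least element, and those with \<open>i\<close> below \<open>k\<close> are
  the non-inversions of its greatest element. Both endpoints depend monotonically on \<open>\<X>\<close>, because
  an induced path from \<open>i\<close> to \<open>k\<close> in a filled graph is monotone and because a flip can only
  enlarge the first set of pairs. Hence \<open>Psi\<close> has a left and a right adjoint and so preserves
  joins and meets. If an edge required by filledness is missing, a join or a meet of words that
  differ only in their first three letters is not preserved.
\<close>

subsection \<open>Words and the weak order\<close>

text \<open>The obstacle is that the order on tubings is generated by flips, and a flip is not given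
  together with two comparable words mapped to its ends; even antisymmetry is not evident. So the
  proof follows an invariant of tubings along flips. Only \<open>tubing_inversions\<close> needs
  this treatment. Its growth gives antisymmetry, because it determines the least word of a fibre,
  and it makes the least words of two comparable tubings comparable in the weak order. The second
  invariant, \<open>tubing_noninversions\<close>, is then compared between these two words, where an
  argument about initial segments suffices. Conversely, most facts about a single maximal tubing are
  read off from some word mapped to it; such a word is a linear extension of the strict part of the
  preorder given by \<open>down\<close>. Monotone paths are used in the form that a tube of a filled
  graph stays connected when it is cut at a threshold.\<close>

primrec before :: "'a list \<Rightarrow> ('a \<times> 'a) set" where
  "before [] = {}"
| "before (x # xs) = {x} \<times> set xs \<union> before xs"

lemma before_iff_nth:
  "(x, y) \<in> before w \<longleftrightarrow> (\<exists>p q. p < q \<and> q < length w \<and> w ! p = x \<and> w ! q = y)"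
proof (induction w)
  case (Cons a w)
  have "(\<exists>p q. p < q \<and> q < length (a # w) \<and> (a # w) ! p = x \<and> (a # w) ! q = y) \<longleftrightarrow>
        (a = x \<and> (\<exists>q < length w. w ! q = y)) \<or> (\<exists>p q. p < q \<and> q < length w \<and> w ! p = x \<and> w ! q = y)"
    (is "?L \<longleftrightarrow> ?R")
  proof
    assume ?L
    then obtain p q where pq: "p < q" "q < length (a # w)" "(a # w) ! p = x" "(a # w) ! q = y" by blast
    then obtain q' where q': "q = Suc q'" by (cases q) auto
    show ?R
    proof (cases p)
      case 0
      then show ?thesis using pq q' by auto
    next
      case (Suc p')
      then have "p' < q' \<and> q' < length w \<and> w ! p' = x \<and> w ! q' = y" using pq q' by simp
      then show ?thesis by blast
    qed
  next
    assume ?R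
    then show ?L
    proof
      assume "a = x \<and> (\<exists>q < length w. w ! q = y)"
      then obtain q where "a = x" "q < length w" "w ! q = y" by blast
      then show ?L by (intro exI[of _ 0] exI[of _ "Suc q"]) simp
    next
      assume "\<exists>p q. p < q \<and> q < length w \<and> w ! p = x \<and> w ! q = y"
      then obtain p q where "p < q" "q < length w" "w ! p = x" "w ! q = y" by blast
      then show ?L by (intro exI[of _ "Suc p"] exI[of _ "Suc q"]) simp
    qed
  qed
  moreover have "(x, y) \<in> before (a # w) \<longleftrightarrow> (a = x \<and> (\<exists>q < length w. w ! q = y)) \<or> (x, y) \<in> before w"
    unfolding before.simps Un_iff mem_Times_iff in_set_conv_nth by fastforce
  ultimately show ?case unfolding Cons.IH by blast
qed simp

lemma before_append: "before (u @ v) = before u \<union> before v \<union> set u \<times> set v"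
  by (induction u) auto

lemma before_subset: "before w \<subseteq> set w \<times> set w"
proof (induction w)
  case (Cons a w)
  then show ?case unfolding before.simps list.set by blast
qed simp

lemma before_irrefl: "distinct w \<Longrightarrow> (x, x) \<notin> before w"
  by (induction w) auto

lemma before_trans: "distinct w \<Longrightarrow> (x, y) \<in> before w \<Longrightarrow> (y, z) \<in> before w \<Longrightarrow> (x, z) \<in> before w"
proof (induction w)
  case (Cons a w)
  have "(x, y) \<in> before w \<Longrightarrow> x \<in> set w \<and> y \<in> set w" for x y
    using before_subset by fast
  with Cons show ?case by (metis Un_iff before.simps(2) distinct.simps(2) mem_Times_iff fst_conv snd_conv singletonD singletonI)
qed simp

lemma before_total: "x \<in> set w \<Longrightarrow> y \<in> set w \<Longrightarrow> x \<noteq> y \<Longrightarrow> (x, y) \<in> before w \<or> (y, x) \<in> before w"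
  by (induction w) auto

lemma before_asym: "distinct w \<Longrightarrow> (x, y) \<in> before w \<Longrightarrow> (y, x) \<notin> before w"
  using before_irrefl[of w x] before_trans[of w x y x] by blast

lemma before_rev: "before (rev w) = (before w)\<inverse>"
  by (induction w) (auto simp: before_append)

lemma before_nth: "distinct w \<Longrightarrow> p < length w \<Longrightarrow> {y. (y, w ! p) \<in> before w} = set (take p w)"
proof (induction w arbitrary: p)
  case (Cons a w)
  have sub: "(x, y) \<in> before w \<Longrightarrow> x \<in> set w \<and> y \<in> set w" for x y
    using before_subset by fast
  show ?case
  proof (cases p)
    case 0
    then show ?thesis using Cons.prems sub by auto
  next
    case (Suc q)
    then have "{y. (y, w ! q) \<in> before w} = set (take q w)" "w ! q \<in> set w" "w ! q \<noteq> a"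
      using Cons by auto
    then show ?thesis using Suc by auto
  qed
qed simp

text \<open>The position of a letter is the number of its predecessors, so it can be recovered from
  the precedence relation.\<close>

lemma before_eq_imp_eq:
  assumes "distinct u" "distinct w" "set u = set w" "before u = before w"
  shows "u = w"
proof (rule nth_equalityI)
  show len: "length u = length w"
    using assms distinct_card by metis
  fix p assume p: "p < length u"
  then obtain q where q: "q < length w" "w ! q = u ! p"
    using assms(3) by (metis in_set_conv_nth nth_mem)
  have "set (take p u) = set (take q w)"
    using before_nth[OF assms(1) p] before_nth[OF assms(2) q(1)] q(2) assms(4) by simp
  then have "card (set (take p u)) = card (set (take q w))" by simp
  then have "p = q"
    using p q assms(1,2) by (simp add: distinct_card)
  then show "u ! p = w ! p" using q by simp
qed

lemma sorted_before:
  fixes f :: "'a \<Rightarrow> nat"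
  assumes "sorted (map f w)" "x \<in> set w" "y \<in> set w" "f x < f y"
  shows "(x, y) \<in> before w"
  using assms
proof (induction w)
  case (Cons a w)
  then show ?case by auto
qed simp

lemma ex_linear_extension:
  fixes f :: "nat \<Rightarrow> nat"
  shows "\<exists>w\<in>permutations_of_set {1..n}. \<forall>x\<in>{1..n}. \<forall>y\<in>{1..n}. f x < f y \<longrightarrow> (x, y) \<in> before w"
proof
  let ?w = "sort_key f [1..<Suc n]"
  show "?w \<in> permutations_of_set {1..n}"
    by (auto simp: permutations_of_set_def)
  show "\<forall>x\<in>{1..n}. \<forall>y\<in>{1..n}. f x < f y \<longrightarrow> (x, y) \<in> before ?w"
    by (auto intro!: sorted_before[of f])
qed

text \<open>The number of predecessors is strictly increasing along a strict order.\<close>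

lemma ex_linear_extension_strict_order:
  fixes r :: "nat \<Rightarrow> nat \<Rightarrow> bool"
  assumes trans: "\<And>x y z. r x y \<Longrightarrow> r y z \<Longrightarrow> r x z" and irrefl: "\<And>x. \<not> r x x"
  shows "\<exists>w\<in>permutations_of_set {1..n}. \<forall>x\<in>{1..n}. \<forall>y\<in>{1..n}. r x y \<longrightarrow> (x, y) \<in> before w"
proof -
  define f where "f y = card {x\<in>{1..n}. r x y}" for y
  have "f x < f y" if "x \<in> {1..n}" "r x y" for x y
    unfolding f_def
  proof (rule psubset_card_mono)
    show "{z\<in>{1..n}. r z x} \<subset> {z\<in>{1..n}. r z y}"
      using that trans irrefl by blast
  qed simp
  with ex_linear_extension[of n f] show ?thesis by blast
qed

section \<open>Inversion sets of permutations\<close>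

lemma inversions_before: "inversions w = {(i, k). i < k \<and> (k, i) \<in> before w}"
  unfolding inversions_def before_iff_nth by blast

lemma permD:
  assumes "w \<in> permutations_of_set {1..n}"
  shows "set w = {1..n}" "distinct w"
  using assms by (auto simp: permutations_of_set_def)

lemma in_inversions: "(i, k) \<in> inversions w \<longleftrightarrow> i < k \<and> (k, i) \<in> before w"
  by (simp add: inversions_before)

lemma inversions_trans:
  assumes "distinct w" "(i, j) \<in> inversions w" "(j, k) \<in> inversions w"
  shows "(i, k) \<in> inversions w"
  using assms before_trans[of w k j i] by (simp add: in_inversions)

lemma inversions_cotrans:
  assumes "distinct w" "(i, k) \<in> inversions w" "i < j" "j < k" "j \<in> set w"
  shows "(i, j) \<in> inversions w \<or> (j, k) \<in> inversions w"
proof -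
  have "k \<in> set w" using assms(2) before_subset[of w] by (auto simp: in_inversions)
  then show ?thesis
    using assms before_trans[of w j k i] before_total[of j w k] by (auto simp: in_inversions)
qed

lemma before_subset_of_inversions_eq:
  assumes "distinct u" "distinct w" "set u = set w" "inversions u = inversions w"
  shows "before u \<subseteq> before w"
proof (rule subrelI)
  fix x y assume xy: "(x, y) \<in> before u"
  show "(x, y) \<in> before w"
  proof (cases "y < x")
    case True
    then show ?thesis using assms(4) xy in_inversions by blast
  next
    case False
    have "x \<noteq> y" using xy before_irrefl[OF assms(1)] by blast
    moreover have "x \<in> set w" "y \<in> set w" using xy before_subset[of u] assms(3) by blast+
    moreover have "(y, x) \<notin> before w"
      using False \<open>x \<noteq> y\<close> before_asym[OF assms(1) xy] assms(4) in_inversions[of x y] by auto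
    ultimately show ?thesis using before_total[of x w y] by blast
  qed
qed

lemma inversions_eq_imp_eq:
  assumes "u \<in> permutations_of_set {1..n}" "w \<in> permutations_of_set {1..n}" "inversions u = inversions w"
  shows "u = w"
proof -
  note u = permD[OF assms(1)] and w = permD[OF assms(2)]
  have "before u = before w"
    using before_subset_of_inversions_eq[of u w] before_subset_of_inversions_eq[of w u] u w assms(3) by simp
  then show ?thesis using before_eq_imp_eq[of u w] u w by simp
qed

text \<open>Reading the pairs in \<open>A\<close> backwards and all others forwards gives a strict
  order \<open>r\<close> that compares any two distinct letters. Of the six relative positions of
  three letters, three get transitivity of \<open>r\<close> from transitivity of \<open>A\<close>
  and three from cotransitivity.\<close>

lemma ex_perm_inversions:
  assumes sub: "\<And>i k. (i, k) \<in> A \<Longrightarrow> i \<in> {1..n} \<and> k \<in> {1..n} \<and> i < k"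
    and trans: "\<And>i j k. (i, j) \<in> A \<Longrightarrow> (j, k) \<in> A \<Longrightarrow> (i, k) \<in> A"
    and cotrans: "\<And>i j k. (i, k) \<in> A \<Longrightarrow> i < j \<Longrightarrow> j < k \<Longrightarrow> (i, j) \<in> A \<or> (j, k) \<in> A"
  shows "\<exists>w\<in>permutations_of_set {1..n}. inversions w = A"
proof -
  define r where "r x y \<longleftrightarrow> (x < y \<and> (x, y) \<notin> A) \<or> (y < x \<and> (y, x) \<in> A)" for x y :: nat
  have irr: "\<not> r x x" for x by (simp add: r_def)
  have tr: "r x z" if "r x y" "r y z" for x y z
  proof -
    have ne: "x \<noteq> y" "y \<noteq> z" using that irr by blast+
    consider "x < y" "y < z" | "x < z" "z < y" | "z < x" "x < y" | "y < x" "x < z" | "y < z" "z < x"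
      | "z < y" "y < x" | "x = z" using ne by linarith
    then show ?thesis
    proof cases
      case 1
      then show ?thesis using that cotrans[of x z y] by (auto simp: r_def)
    next
      case 2
      then show ?thesis using that trans[of x z y] by (auto simp: r_def)
    next
      case 3
      then show ?thesis using that cotrans[of z y x] by (auto simp: r_def)
    next
      case 4
      then show ?thesis using that trans[of y x z] by (auto simp: r_def)
    next
      case 5
      then show ?thesis using that cotrans[of y x z] by (auto simp: r_def)
    next
      case 6
      then show ?thesis using that trans[of z y x] by (auto simp: r_def)
    next
      case 7
      then show ?thesis using that by (auto simp: r_def)
    qed
  qed
  have "\<exists>w\<in>permutations_of_set {1..n}. \<forall>x\<in>{1..n}. \<forall>y\<in>{1..n}. r x y \<longrightarrow> (x, y) \<in> before w"
    by (rule ex_linear_extension_strict_order) (use tr irr in blast)+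
  then obtain w where
    w: "w \<in> permutations_of_set {1..n}" "\<And>x y. x \<in> {1..n} \<Longrightarrow> y \<in> {1..n} \<Longrightarrow> r x y \<Longrightarrow> (x, y) \<in> before w"
    by blast
  note pw = permD[OF w(1)]
  have "(i, k) \<in> inversions w \<longleftrightarrow> (i, k) \<in> A" for i k
  proof
    assume a: "(i, k) \<in> A"
    then have "i \<in> {1..n}" "k \<in> {1..n}" "i < k" using sub by blast+
    then show "(i, k) \<in> inversions w"
      using w(2)[of k i] a by (auto simp: inversions_before r_def)
  next
    assume a: "(i, k) \<in> inversions w"
    then have *: "i < k" "(k, i) \<in> before w" by (auto simp: inversions_before)
    then have "i \<in> {1..n}" "k \<in> {1..n}" using before_subset[of w] pw by auto
    then show "(i, k) \<in> A"
      using w(2)[of i k] * before_asym[OF pw(2), of k i] by (auto simp: r_def)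
  qed
  then show ?thesis using w(1) by (intro bexI[of _ w]) auto
qed

text \<open>The inversions of the join form the transitive closure of the union: upper bounds have
  transitive inversion sets, so they contain it. Cotransitivity survives the closure because along
  an increasing chain from \<open>i\<close> to \<open>k\<close> the letter \<open>j\<close> is a
  chain point or lies inside one step, and that step splits in \<open>x\<close> or in
  \<open>y\<close>.\<close>

lemma ex_weak_order_join:
  assumes "x \<in> permutations_of_set {1..n}" "y \<in> permutations_of_set {1..n}"
  shows "\<exists>z\<in>permutations_of_set {1..n}. inversions x \<subseteq> inversions z \<and> inversions y \<subseteq> inversions z \<and>
    (\<forall>v\<in>permutations_of_set {1..n}. inversions x \<subseteq> inversions v \<and> inversions y \<subseteq> inversions v
       \<longrightarrow> inversions z \<subseteq> inversions v)"
proof -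
  note x = permD[OF assms(1)] and y = permD[OF assms(2)]
  define A where "A = inversions x \<union> inversions y"
  have sub: "(i, k) \<in> A \<Longrightarrow> i \<in> {1..n} \<and> k \<in> {1..n} \<and> i < k" for i k
    using before_subset[of x] before_subset[of y] x y by (auto simp: A_def inversions_before)
  have sub': "i \<in> {1..n} \<and> k \<in> {1..n} \<and> i < k" if "(i, k) \<in> A\<^sup>+" for i k
    using that by induction (use sub in fastforce)+
  have cot: "(i, j) \<in> A\<^sup>+ \<or> (j, k) \<in> A\<^sup>+" if "(i, k) \<in> A\<^sup>+" "i < j" "j < k" for i j k
    using that
  proof (induction arbitrary: j)
    case (base k)
    then have "j \<in> set x" "j \<in> set y" using sub[of i k] x y by auto
    with base show ?case 
      using inversions_cotrans[of x i k j] inversions_cotrans[of y i k j] x y by (auto simp: A_def)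
  next
    case (step b k)
    consider "j < b" | "j = b" | "b < j" by linarith
    then show ?case
    proof cases
      case 1
      then show ?thesis using step by (meson trancl.trancl_into_trancl)
    next
      case 2
      then show ?thesis using step by blast
    next
      case 3
      have "j \<in> set x" "j \<in> set y" using 3 sub[of b k] x y step by auto
      then have "(b, j) \<in> A \<or> (j, k) \<in> A"
        using 3 step inversions_cotrans[of x b k j] inversions_cotrans[of y b k j] x y by (auto simp: A_def)
      then show ?thesis using step by (meson trancl.simps)
    qed
  qed
  have "\<exists>z\<in>permutations_of_set {1..n}. inversions z = A\<^sup>+"
  proof (rule ex_perm_inversions)
    show "i \<in> {1..n} \<and> k \<in> {1..n} \<and> i < k" if "(i, k) \<in> A\<^sup>+" for i k
      using that by (rule sub')
    show "(i, k) \<in> A\<^sup>+" if "(i, j) \<in> A\<^sup>+" "(j, k) \<in> A\<^sup>+" for i j k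
      using that by (rule trancl_trans)
    show "(i, j) \<in> A\<^sup>+ \<or> (j, k) \<in> A\<^sup>+" if "(i, k) \<in> A\<^sup>+" "i < j" "j < k" for i j k
      using that by (rule cot)
  qed
  then obtain z where z: "z \<in> permutations_of_set {1..n}" "inversions z = A\<^sup>+" by blast
  have "A\<^sup>+ \<subseteq> inversions v" if "v \<in> permutations_of_set {1..n}" "A \<subseteq> inversions v" for v
  proof -
    have "trans (inversions v)" 
      using inversions_trans permD(2)[OF that(1)] by (auto intro!: transI)
    then show ?thesis using that(2) by (metis trancl_id trancl_mono_subset)
  qed
  then show ?thesis using z by (intro bexI[of _ z]) (auto simp: A_def)
qed

text \<open>Reversal complements the inversion set among all increasing pairs. It is thus an
  anti-automorphism of the weak order, which turns joins into meets.\<close>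

lemma inversions_rev_subset_iff:
  assumes "x \<in> permutations_of_set {1..n}" "y \<in> permutations_of_set {1..n}"
  shows "inversions (rev x) \<subseteq> inversions (rev y) \<longleftrightarrow> inversions y \<subseteq> inversions x"
proof -
  have *: "inversions (rev w) = {(i, k). i \<in> {1..n} \<and> k \<in> {1..n} \<and> i < k} - inversions w"
    if "w \<in> permutations_of_set {1..n}" for w
  proof -
    note w = permD[OF that]
    have "(i, k) \<in> before w \<longleftrightarrow> i \<in> {1..n} \<and> k \<in> {1..n} \<and> (k, i) \<notin> before w" if "i < k" for i k
      using that before_total[of i w k] before_asym[OF w(2), of i k] before_subset[of w] w(1) by blast
    then show ?thesis by (auto simp: inversions_before before_rev)
  qed
  have "inversions w \<subseteq> {(i, k). i \<in> {1..n} \<and> k \<in> {1..n} \<and> i < k}" (is "_ \<subseteq> ?D")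
    if "w \<in> permutations_of_set {1..n}" for w
    using permD[OF that] before_subset[of w] by (auto simp: inversions_before)
  from this[OF assms(1)] this[OF assms(2)] show ?thesis
    unfolding *[OF assms(1)] *[OF assms(2)] by blast
qed

lemma ex_weak_order_meet:
  assumes "x \<in> permutations_of_set {1..n}" "y \<in> permutations_of_set {1..n}"
  shows "\<exists>z\<in>permutations_of_set {1..n}. inversions z \<subseteq> inversions x \<and> inversions z \<subseteq> inversions y \<and>
    (\<forall>v\<in>permutations_of_set {1..n}. inversions v \<subseteq> inversions x \<and> inversions v \<subseteq> inversions y
       \<longrightarrow> inversions v \<subseteq> inversions z)"
proof -
  have rev: "rev v \<in> permutations_of_set {1..n} \<longleftrightarrow> v \<in> permutations_of_set {1..n}" for v :: "nat list"
    by (simp add: permutations_of_set_def)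
  obtain z where z: "z \<in> permutations_of_set {1..n}" 
    "inversions (rev x) \<subseteq> inversions z" "inversions (rev y) \<subseteq> inversions z"
    "\<And>v. v \<in> permutations_of_set {1..n} \<Longrightarrow> inversions (rev x) \<subseteq> inversions v \<Longrightarrow> 
       inversions (rev y) \<subseteq> inversions v \<Longrightarrow> inversions z \<subseteq> inversions v"
    using ex_weak_order_join[of "rev x" n "rev y"] assms rev by blast
  have iff: "inversions (rev z) \<subseteq> inversions v \<longleftrightarrow> inversions (rev v) \<subseteq> inversions z"
    "inversions v \<subseteq> inversions (rev z) \<longleftrightarrow> inversions z \<subseteq> inversions (rev v)"
    if "v \<in> permutations_of_set {1..n}" for v
    using inversions_rev_subset_iff[OF z(1), of "rev v"] inversions_rev_subset_iff[OF _ z(1), of "rev v"] rev that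
    by simp_all
  show ?thesis
  proof (intro bexI[of _ "rev z"] conjI ballI impI)
    show "inversions (rev z) \<subseteq> inversions x" "inversions (rev z) \<subseteq> inversions y" "rev z \<in> permutations_of_set {1..n}"
      using iff(1) assms z(1-3) rev by simp_all
    fix v assume v: "v \<in> permutations_of_set {1..n}" "inversions v \<subseteq> inversions x \<and> inversions v \<subseteq> inversions y"
    then have "inversions (rev x) \<subseteq> inversions (rev v)" "inversions (rev y) \<subseteq> inversions (rev v)"
      using inversions_rev_subset_iff assms by simp_all
    then show "inversions v \<subseteq> inversions (rev z)"
      using z(4) iff(2) v(1) rev by simp
  qed
qed

lemma partial_order_weak_order: "partial_order (weak_order n)"
  unfolding weak_order_def
  by unfold_locales (simp_all del: One_nat_def, rule inversions_eq_imp_eq[of _ n], simp_all)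

lemma lattice_weak_order: "Lattice.lattice (weak_order n)"
proof -
  interpret partial_order "weak_order n" by (rule partial_order_weak_order)
  show ?thesis
  proof
    fix x y assume "x \<in> carrier (weak_order n)" "y \<in> carrier (weak_order n)"
    then have xy: "x \<in> permutations_of_set {1..n}" "y \<in> permutations_of_set {1..n}"
      by (simp_all add: weak_order_def)
    obtain z where "z \<in> permutations_of_set {1..n}" "inversions x \<subseteq> inversions z" "inversions y \<subseteq> inversions z"
      "\<And>v. v \<in> permutations_of_set {1..n} \<Longrightarrow> inversions x \<subseteq> inversions v \<Longrightarrow> inversions y \<subseteq> inversions v \<Longrightarrow>
        inversions z \<subseteq> inversions v"
      using ex_weak_order_join[OF xy] by blast
    then have "least (weak_order n) z (Upper (weak_order n) {x, y})"
      using xy by (simp add: least_def Upper_def weak_order_def)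
    then show "\<exists>s. least (weak_order n) s (Upper (weak_order n) {x, y})" by (rule exI)
    obtain z where "z \<in> permutations_of_set {1..n}" "inversions z \<subseteq> inversions x" "inversions z \<subseteq> inversions y"
      "\<And>v. v \<in> permutations_of_set {1..n} \<Longrightarrow> inversions v \<subseteq> inversions x \<Longrightarrow> inversions v \<subseteq> inversions y \<Longrightarrow>
        inversions v \<subseteq> inversions z"
      using ex_weak_order_meet[OF xy] by blast
    then have "greatest (weak_order n) z (Lower (weak_order n) {x, y})"
      using xy by (simp add: greatest_def Lower_def weak_order_def)
    then show "\<exists>s. greatest (weak_order n) s (Lower (weak_order n) {x, y})" by (rule exI)
  qed
qed

subsection \<open>Tubes\<close>

lemma sym_induced_adj: "sym (induced_adj E I)"
  by (auto simp: sym_def induced_adj_def insert_commute)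

lemma linked_sym: "(x, y) \<in> (induced_adj E I)\<^sup>* \<Longrightarrow> (y, x) \<in> (induced_adj E I)\<^sup>*"
  using sym_rtrancl[OF sym_induced_adj] by (rule symD)

lemma linked_mono: "(x, y) \<in> (induced_adj E I)\<^sup>* \<Longrightarrow> I \<subseteq> J \<Longrightarrow> (x, y) \<in> (induced_adj E J)\<^sup>*"
  by (rule rtrancl_mono[THEN subsetD]) (auto simp: induced_adj_def)

lemma linked_edge: "x \<in> I \<Longrightarrow> y \<in> I \<Longrightarrow> {x, y} \<in> E \<Longrightarrow> (x, y) \<in> (induced_adj E I)\<^sup>*"
  by (auto simp: induced_adj_def)

lemma tubeI:
  assumes "r \<in> I" "I \<subseteq> {1..n}" "\<And>y. y \<in> I \<Longrightarrow> (r, y) \<in> (induced_adj E I)\<^sup>*"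
  shows "tube n E I"
  unfolding tube_def using assms by (metis empty_iff linked_sym rtrancl_trans)

lemma tube_linked: "tube n E I \<Longrightarrow> x \<in> I \<Longrightarrow> y \<in> I \<Longrightarrow> (x, y) \<in> (induced_adj E I)\<^sup>*"
  by (simp add: tube_def)

lemma tubeD:
  assumes "tube n E I"
  shows "I \<noteq> {}" "I \<subseteq> {1..n}" "finite I"
proof -
  show "I \<noteq> {}" "I \<subseteq> {1..n}" using assms by (simp_all add: tube_def)
  then show "finite I" using finite_subset by blast
qed

lemma tube_component:
  assumes "x \<in> I" "I \<subseteq> {1..n}"
  shows "tube n E (component E I x)"
proof (rule tubeI)
  show "x \<in> component E I x" using assms by (simp add: component_def)
  show "component E I x \<subseteq> {1..n}" using assms by (auto simp: component_def)
  fix y assume "y \<in> component E I x"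
  then have "(x, y) \<in> (induced_adj E I)\<^sup>*" by (simp add: component_def)
  then show "(x, y) \<in> (induced_adj E (component E I x))\<^sup>*"
  proof induction
    case (step y z)
    then have "y \<in> component E I x" "z \<in> component E I x"
      by (auto simp: component_def induced_adj_def intro: rtrancl.rtrancl_into_rtrancl)
    moreover have "{y, z} \<in> E" using step by (simp add: induced_adj_def)
    ultimately show ?case using step.IH linked_edge rtrancl_trans by metis
  qed simp
qed

lemma tube_subset_component: "tube n E S \<Longrightarrow> S \<subseteq> I \<Longrightarrow> x \<in> S \<Longrightarrow> S \<subseteq> component E I x"
  unfolding component_def using tube_linked linked_mono by blast

lemma component_mono: "I \<subseteq> J \<Longrightarrow> component E I x \<subseteq> component E J x"
  unfolding component_def using linked_mono by blast

lemma component_subset: "component E I x \<subseteq> I"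
  by (simp add: component_def)

lemma component_refl: "x \<in> I \<Longrightarrow> x \<in> component E I x"
  by (simp add: component_def)

lemma tube_Un:
  assumes S: "tube n E S" and T: "tube n E T" and "s \<in> S" "t \<in> T" and st: "s = t \<or> {s, t} \<in> E"
  shows "tube n E (S \<union> T)"
proof (rule tubeI)
  show "s \<in> S \<union> T" using assms by simp
  show "S \<union> T \<subseteq> {1..n}" using S T by (simp add: tube_def)
  fix y assume "y \<in> S \<union> T"
  have "(s, t) \<in> (induced_adj E (S \<union> T))\<^sup>*"
    using linked_edge[of s "S \<union> T" t E] assms by auto
  moreover have "y \<in> T \<Longrightarrow> (t, y) \<in> (induced_adj E (S \<union> T))\<^sup>*"
    using tube_linked[OF T \<open>t \<in> T\<close>] linked_mono by blast
  moreover have "y \<in> S \<Longrightarrow> (s, y) \<in> (induced_adj E (S \<union> T))\<^sup>*"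
    using tube_linked[OF S \<open>s \<in> S\<close>] linked_mono by blast
  ultimately show "(s, y) \<in> (induced_adj E (S \<union> T))\<^sup>*"
    using \<open>y \<in> S \<union> T\<close> by (meson UnE rtrancl_trans)
qed

text \<open>A path from inside \<open>S\<close> to outside has an edge where it leaves. Whenever a
  tube is not contained in a set it meets, this supplies a neighbour of that set.\<close>

lemma tube_boundary:
  assumes T: "tube n E T" and x: "x \<in> T" "x \<in> S" and y: "y \<in> T" "y \<notin> S"
  obtains s t where "s \<in> T" "s \<in> S" "t \<in> T" "t \<notin> S" "{s, t} \<in> E"
proof -
  have "(x, y) \<in> (induced_adj E T)\<^sup>*" using tube_linked T x y by blast
  then have "y \<notin> S \<longrightarrow> (\<exists>s t. s \<in> T \<and> s \<in> S \<and> t \<in> T \<and> t \<notin> S \<and> {s, t} \<in> E)"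
  proof induction
    case base
    then show ?case using x by blast
  next
    case (step y z)
    then show ?case by (auto simp: induced_adj_def)
  qed
  then show thesis using y that by blast
qed

text \<open>Steps leaving \<open>C\<close> are rerouted through the gate \<open>m\<close>.\<close>

lemma tube_retract:
  assumes S: "tube n E S" and C: "C \<subseteq> S" "m \<in> C"
    and gate: "\<And>u v. u \<in> C \<Longrightarrow> v \<in> S - C \<Longrightarrow> {u, v} \<in> E \<Longrightarrow> u = m \<or> {u, m} \<in> E"
  shows "tube n E C"
proof (rule tubeI)
  show "m \<in> C" by fact
  show "C \<subseteq> {1..n}" using S C by (auto simp: tube_def)
  fix y assume "y \<in> C"
  then have "(m, y) \<in> (induced_adj E S)\<^sup>*" using tube_linked[OF S, of m y] C by blast
  then have "y \<in> C \<longrightarrow> (m, y) \<in> (induced_adj E C)\<^sup>*"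
  proof induction
    case (step y z)
    show ?case
    proof
      assume z: "z \<in> C"
      have yz: "y \<in> S" "{y, z} \<in> E" using step by (auto simp: induced_adj_def)
      show "(m, z) \<in> (induced_adj E C)\<^sup>*"
      proof (cases "y \<in> C")
        case True
        with step.IH have "(m, y) \<in> (induced_adj E C)\<^sup>*" by simp
        then show ?thesis using linked_edge[OF True z yz(2)] by (rule rtrancl_trans)
      next
        case False
        with gate[OF z, of y] yz have "z = m \<or> {m, z} \<in> E" by (auto simp: insert_commute)
        then show ?thesis using linked_edge[OF \<open>m \<in> C\<close> z] by auto
      qed
    qed
  qed simp
  with \<open>y \<in> C\<close> show "(m, y) \<in> (induced_adj E C)\<^sup>*" by blast
qed

section \<open>Tubes of filled graphs\<close>

lemma filled_edge_left: "filled E \<Longrightarrow> {i, k} \<in> E \<Longrightarrow> i < j \<Longrightarrow> j < k \<Longrightarrow> {i, j} \<in> E"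
  unfolding filled_def by blast

lemma filled_edge_right: "filled E \<Longrightarrow> {i, k} \<in> E \<Longrightarrow> i < j \<Longrightarrow> j < k \<Longrightarrow> {j, k} \<in> E"
  unfolding filled_def by blast

text \<open>The least remaining vertex serves as the gate: an edge from a remaining \<open>u\<close>
  to a removed \<open>v\<close> spans it, so filledness makes it equal or adjacent to
  \<open>u\<close>. The next lemma is the mirror image.\<close>

lemma filled_tube_atLeast:
  assumes "filled E" and S: "tube n E S" and "x \<in> S" "a \<le> x"
  shows "tube n E (S \<inter> {a..})"
proof -
  let ?C = "S \<inter> {a..}"
  have fin: "finite ?C" using tubeD[OF S] by simp
  have m: "Min ?C \<in> ?C" using assms by (intro Min_in[OF fin]) auto
  show ?thesis
  proof (rule tube_retract[OF S _ m])
    fix u v assume uv: "u \<in> ?C" "v \<in> S - ?C" "{u, v} \<in> E"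
    have "Min ?C \<le> u" using fin uv(1) by (rule Min_le)
    moreover have "v < Min ?C" using m uv(2) by auto
    ultimately show "u = Min ?C \<or> {u, Min ?C} \<in> E"
      using filled_edge_right[OF assms(1), of v u "Min ?C"] uv(3) by (auto simp: insert_commute le_less)
  qed auto
qed

lemma filled_tube_atMost:
  assumes "filled E" and S: "tube n E S" and "x \<in> S" "x \<le> b"
  shows "tube n E (S \<inter> {..b})"
proof -
  let ?C = "S \<inter> {..b}"
  have fin: "finite ?C" by auto
  have m: "Max ?C \<in> ?C" using assms by (intro Max_in[OF fin]) auto
  show ?thesis
  proof (rule tube_retract[OF S _ m])
    fix u v assume uv: "u \<in> ?C" "v \<in> S - ?C" "{u, v} \<in> E"
    have "u \<le> Max ?C" using fin uv(1) by (rule Max_ge)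
    moreover have "Max ?C < v" using m uv(2) by auto
    ultimately show "u = Max ?C \<or> {u, Max ?C} \<in> E"
      using filled_edge_left[OF assms(1), of u v "Max ?C"] uv(3) by (auto simp: le_less)
  qed auto
qed

text \<open>If \<open>j\<close> is not in \<open>S\<close>, some edge of the tube jumps over
  \<open>j\<close>, and filledness joins its lower end to \<open>j\<close>.\<close>

lemma filled_tube_cross:
  assumes "filled E" and S: "tube n E S" and "p \<in> S" "q \<in> S" "p < j" "j < q"
  shows "\<exists>u\<in>S. u = j \<or> {u, j} \<in> E"
proof (rule ccontr)
  assume neg: "\<not> ?thesis"
  obtain s t where st: "s \<in> S" "s \<in> {..j}" "t \<in> S" "t \<notin> {..j}" "{s, t} \<in> E"
    using tube_boundary[OF S, of p "{..j}" q] assms by auto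
  then have "s < j" "j < t" using neg by (auto simp: le_less)
  then show False using filled_edge_left[OF assms(1) st(5)] neg st by blast
qed

subsection \<open>The tubing of a word\<close>

text \<open>The initial segment of \<open>w\<close> ending with \<open>x\<close>. Indexing segments
  by their last letter rather than by their length attaches each tube of \<open>Psi\<close> to a
  vertex.\<close>

definition pre :: "'a list \<Rightarrow> 'a \<Rightarrow> 'a set" where
  "pre w x = insert x {y. (y, x) \<in> before w}"

text \<open>For a maximal tubing \<open>\<X>\<close>, \<open>down \<X> x\<close> is the tube with top \<open>x\<close>.\<close>

definition down :: "nat set set \<Rightarrow> nat \<Rightarrow> nat set" where
  "down \<X> x = {y. \<forall>T\<in>\<X>. x \<in> T \<longrightarrow> y \<in> T}"

lemma pre_refl: "x \<in> pre w x"
  by (simp add: pre_def)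

lemma pre_subset: "x \<in> set w \<Longrightarrow> pre w x \<subseteq> set w"
  using before_subset[of w] by (auto simp: pre_def)

lemma pre_mono: "distinct w \<Longrightarrow> y \<in> pre w x \<Longrightarrow> pre w y \<subseteq> pre w x"
  using before_trans[of w _ y x] by (auto simp: pre_def)

lemma pre_antisym: "distinct w \<Longrightarrow> y \<in> pre w x \<Longrightarrow> x \<in> pre w y \<Longrightarrow> x = y"
  using before_asym[of w x y] by (auto simp: pre_def)

lemma pre_total: "x \<in> set w \<Longrightarrow> y \<in> set w \<Longrightarrow> x \<in> pre w y \<or> y \<in> pre w x"
  using before_total[of x w y] by (auto simp: pre_def)

lemma pre_nth: "distinct w \<Longrightarrow> p < length w \<Longrightarrow> pre w (w ! p) = set (take (Suc p) w)"
  using before_nth[of w p] by (simp add: pre_def take_Suc_conv_app_nth)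

lemma Psi_eq_pre:
  assumes "distinct w"
  shows "Psi E w = (\<lambda>x. component E (pre w x) x) ` set w"
proof -
  have "set w = (!) w ` {..<length w}" by (auto simp: in_set_conv_nth)
  then have "(\<lambda>x. component E (pre w x) x) ` set w = (\<lambda>p. component E (pre w (w ! p)) (w ! p)) ` {..<length w}"
    by (simp add: image_image)
  also have "\<dots> = (\<lambda>p. component E (set (take (Suc p) w)) (w ! p)) ` {..<length w}"
    using pre_nth[OF assms] by (intro image_cong) auto
  also have "\<dots> = (\<lambda>j. component E (set (take j w)) (w ! (j - 1))) ` Suc ` {..<length w}"
    by (simp add: image_image)
  also have "Suc ` {..<length w} = {1..length w}"
    by (simp add: image_Suc_lessThan)
  finally show ?thesis by (simp add: Psi_def)
qed

lemma ex_last: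
  assumes "distinct w" "finite C" "C \<noteq> {}" "C \<subseteq> set w"
  shows "\<exists>t\<in>C. C \<subseteq> pre w t"
  using assms(2-)
proof (induction rule: finite_ne_induct)
  case (singleton x)
  then show ?case by (simp add: pre_refl)
next
  case (insert x F)
  then obtain t where t: "t \<in> F" "F \<subseteq> pre w t" by auto
  then have "t \<in> set w" "x \<in> set w" using insert by auto
  then consider "x \<in> pre w t" | "t \<in> pre w x" using pre_total by metis
  then show ?case
  proof cases
    case 1
    then show ?thesis using t by blast
  next
    case 2
    then show ?thesis using t pre_mono[OF assms(1) 2] pre_refl[of x w] by blast
  qed
qed

text \<open>If \<open>x\<close> is read no later than \<open>y\<close> and the union of their
  components is a tube, this union contains \<open>y\<close> and lies in \<open>pre w y\<close>, so
  the component of \<open>y\<close> absorbs it.\<close>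

lemma tubing_Psi:
  assumes "w \<in> permutations_of_set {1..n}"
  shows "tubing n E (Psi E w)"
proof -
  note w = permD[OF assms]
  let ?X = "\<lambda>x. component E (pre w x) x"
  have tube: "tube n E (?X x)" if "x \<in> {1..n}" for x
    using tube_component[OF pre_refl] pre_subset[of x w] w that by simp
  have *: "compatible n E (?X x) (?X y)" if "x \<in> {1..n}" "y \<in> {1..n}" "x \<in> pre w y" for x y
  proof (cases "tube n E (?X x \<union> ?X y)")
    case True
    moreover have "?X x \<union> ?X y \<subseteq> pre w y"
      using pre_mono[OF w(2) that(3)] component_subset[of E "pre w x" x] component_subset[of E "pre w y" y] by blast
    moreover have "y \<in> ?X x \<union> ?X y" using component_refl[OF pre_refl] by blast
    ultimately have "?X x \<union> ?X y \<subseteq> ?X y" by (rule tube_subset_component)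
    then show ?thesis by (simp add: compatible_def)
  qed (simp add: compatible_def)
  have sym: "compatible n E I J \<Longrightarrow> compatible n E J I" for I J
    by (auto simp: compatible_def Un_commute)
  have "compatible n E (?X x) (?X y)" if "x \<in> {1..n}" "y \<in> {1..n}" for x y
    using *[of x y] *[of y x] sym that pre_total[of x w y] w(1) by blast
  then show ?thesis
    unfolding tubing_def Psi_eq_pre[OF w(2)] w(1) using tube by blast
qed

text \<open>A tube \<open>I\<close> that can be added must be the component closed by its last
  letter \<open>m\<close>. Otherwise that component leaves \<open>I\<close> along an edge to some
  \<open>y\<close> read before \<open>m\<close>; the tube closed by \<open>y\<close> touches
  \<open>I\<close>, contains \<open>y\<close> but not \<open>m\<close>, and is therefore
  incompatible with \<open>I\<close>.\<close>

lemma Psi_in_MTub: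
  assumes perm: "w \<in> permutations_of_set {1..n}"
  shows "Psi E w \<in> MTub n E"
proof -
  note w = permD[OF perm]
  let ?X = "\<lambda>x. component E (pre w x) x"
  have "I \<in> Psi E w" if \<Y>: "tubing n E \<Y>" "Psi E w \<subseteq> \<Y>" "I \<in> \<Y>" for \<Y> I
  proof -
    have I: "tube n E I" using \<Y> by (simp add: tubing_def)
    then have "I \<noteq> {}" "I \<subseteq> set w" "finite I" using w(1) tubeD by simp_all
    then obtain m where m: "m \<in> I" "I \<subseteq> pre w m" using ex_last[OF w(2), of I] by blast
    have sub: "I \<subseteq> ?X m" using tube_subset_component[OF I m(2,1)] .
    have "?X m \<subseteq> I"
    proof (rule ccontr)
      assume "\<not> ?X m \<subseteq> I"
      then obtain z where z: "z \<in> ?X m" "z \<notin> I" by blast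
      have "m \<in> set w" using m \<open>I \<subseteq> set w\<close> by blast
      then have "tube n E (?X m)" using tube_component[OF pre_refl, of w m n E] pre_subset[of m w] w(1) by simp
      then obtain s y where sy: "s \<in> I" "y \<in> ?X m" "y \<notin> I" "{s, y} \<in> E"
        using tube_boundary[of n E "?X m" m I z] z sub m(1) by (metis subsetD)
      have "y \<in> pre w m" using sy(2) component_subset[of E "pre w m" m] by blast
      then have yw: "y \<in> set w" using pre_subset[of m w] m \<open>I \<subseteq> set w\<close> by blast
      have XY: "?X y \<in> \<Y>" using yw \<Y>(2) Psi_eq_pre[OF w(2), of E] by blast
      have "m \<notin> pre w y" using pre_antisym[OF w(2) \<open>y \<in> pre w m\<close>] sy(3) m(1) by blast
      then have "\<not> I \<subseteq> ?X y" using m(1) component_subset[of E "pre w y" y] by blast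
      moreover have "\<not> ?X y \<subseteq> I" using sy(3) component_refl[OF pre_refl, of y E w] by blast
      moreover have "tube n E (?X y)" using \<Y>(1) XY by (simp add: tubing_def)
      then have "tube n E (I \<union> ?X y)"
        using tube_Un[OF I _ sy(1)] sy(4) component_refl[OF pre_refl, of y E w] by blast
      moreover have "compatible n E I (?X y)" using \<Y> XY by (simp add: tubing_def)
      ultimately show False by (simp add: compatible_def)
    qed
    with sub have "I = ?X m" by blast
    then show ?thesis using Psi_eq_pre[OF w(2), of E] m(1) \<open>I \<subseteq> set w\<close> by blast
  qed
  then show ?thesis using tubing_Psi[OF perm] unfolding MTub_def by blast
qed

text \<open>A neighbour \<open>y\<close> of a tube \<open>I\<close> outside \<open>I\<close> is strictly above all of \<open>I\<close>, so \<open>I\<close> is closed off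
  when its last element is read.\<close>

lemma tubing_subset_Psi:
  assumes \<X>: "tubing n E \<X>" and perm: "w \<in> permutations_of_set {1..n}"
    and ext: "\<And>x y. x \<in> {1..n} \<Longrightarrow> y \<in> {1..n} \<Longrightarrow> x \<in> down \<X> y \<Longrightarrow> y \<notin> down \<X> x \<Longrightarrow> (x, y) \<in> before w"
  shows "\<X> \<subseteq> Psi E w"
proof
  note w = permD[OF perm]
  fix I assume I\<X>: "I \<in> \<X>"
  then have I: "tube n E I" using \<X> by (simp add: tubing_def)
  then have "I \<noteq> {}" "I \<subseteq> set w" "finite I" using w(1) tubeD by simp_all
  then obtain m where m: "m \<in> I" "I \<subseteq> pre w m" using ex_last[OF w(2), of I] by blast
  have mw: "m \<in> set w" using m \<open>I \<subseteq> set w\<close> by blast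
  have above: "(m, y) \<in> before w" if "s \<in> I" "y \<notin> I" "y \<in> {1..n}" "{s, y} \<in> E" for s y
  proof (rule ext)
    show "m \<in> {1..n}" using mw w by simp
    show "y \<notin> down \<X> m" using I\<X> m(1) that(2) by (auto simp: down_def)
    show "m \<in> down \<X> y"
      unfolding down_def
    proof (intro CollectI ballI impI)
      fix J assume J: "J \<in> \<X>" "y \<in> J"
      then have "tube n E J" using \<X> by (simp add: tubing_def)
      then have "tube n E (I \<union> J)" using tube_Un[OF I _ that(1)] J(2) that(4) by blast
      moreover have "compatible n E I J" using \<X> I\<X> J by (simp add: tubing_def)
      ultimately have "I \<subseteq> J" using J that(2) by (auto simp: compatible_def)
      then show "m \<in> J" using m by blast
    qed
  qed fact
  have "component E (pre w m) m \<subseteq> I"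
  proof (rule ccontr)
    assume "\<not> component E (pre w m) m \<subseteq> I"
    then obtain z where z: "z \<in> component E (pre w m) m" "z \<notin> I" by blast
    have T: "tube n E (component E (pre w m) m)" using tube_component[OF pre_refl] pre_subset[OF mw] w by simp
    obtain s y where sy: "s \<in> I" "y \<in> component E (pre w m) m" "y \<notin> I" "{s, y} \<in> E"
      using tube_boundary[OF T component_refl[OF pre_refl] m(1) z] by metis
    have "y \<in> pre w m" using sy(2) component_subset[of E "pre w m" m] by blast
    moreover have "y \<in> {1..n}" using calculation pre_subset[OF mw] w by blast
    then have "m \<in> pre w y" using above[OF sy(1,3) _ sy(4)] by (simp add: pre_def)
    ultimately show False using pre_antisym[OF w(2)] sy(3) m(1) by blast
  qed
  moreover have "I \<subseteq> component E (pre w m) m" using tube_subset_component[OF I m(2,1)] .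
  ultimately show "I \<in> Psi E w" using Psi_eq_pre[OF w(2), of E] mw by blast
qed

text \<open>Maximality turns the inclusion into equality, so no tubes have to be counted. The
  assumption refers to the strict part of the preorder because antisymmetry of \<open>down\<close>
  is only obtained later, from the existence of such a word.\<close>

lemma Psi_eqI:
  assumes \<X>: "\<X> \<in> MTub n E" and perm: "w \<in> permutations_of_set {1..n}"
    and ext: "\<And>x y. x \<in> {1..n} \<Longrightarrow> y \<in> {1..n} \<Longrightarrow> x \<in> down \<X> y \<Longrightarrow> y \<notin> down \<X> x \<Longrightarrow> (x, y) \<in> before w"
  shows "Psi E w = \<X>"
proof -
  have "\<X> \<subseteq> Psi E w" using tubing_subset_Psi[OF _ perm ext] \<X> by (simp add: MTub_def)
  then show ?thesis using \<X> tubing_Psi[OF perm] by (simp add: MTub_def)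
qed

lemma ex_Psi_eq:
  assumes "\<X> \<in> MTub n E"
  obtains w where "w \<in> permutations_of_set {1..n}" "Psi E w = \<X>"
proof -
  define r where "r x y \<longleftrightarrow> x \<in> down \<X> y \<and> y \<notin> down \<X> x" for x y
  have "\<exists>w\<in>permutations_of_set {1..n}. \<forall>x\<in>{1..n}. \<forall>y\<in>{1..n}. r x y \<longrightarrow> (x, y) \<in> before w"
    by (rule ex_linear_extension_strict_order) (auto simp: r_def down_def)
  then obtain w where "w \<in> permutations_of_set {1..n}"
    "\<And>x y. x \<in> {1..n} \<Longrightarrow> y \<in> {1..n} \<Longrightarrow> r x y \<Longrightarrow> (x, y) \<in> before w" by blast
  with Psi_eqI[OF assms, of w] that show thesis by (simp add: r_def)
qed

text \<open>A tube of \<open>Psi\<close> that contains \<open>x\<close>, say the one closed by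
  \<open>z\<close>, forms a connected union with the component of \<open>x\<close>. The union lies
  in \<open>pre w z\<close>, so it adds nothing to the tube closed by \<open>z\<close>.\<close>

lemma down_Psi:
  assumes perm: "w \<in> permutations_of_set {1..n}" and x: "x \<in> {1..n}"
  shows "down (Psi E w) x = component E (pre w x) x"
proof -
  note w = permD[OF perm]
  have "y \<in> component E (pre w x) x" if "y \<in> down (Psi E w) x" for y
    using that x w(1) component_refl[OF pre_refl, of x E w] unfolding down_def Psi_eq_pre[OF w(2)] by blast
  moreover have "component E (pre w x) x \<subseteq> component E (pre w z) z"
    if z: "z \<in> {1..n}" "x \<in> component E (pre w z) z" for z
  proof -
    let ?U = "component E (pre w z) z \<union> component E (pre w x) x"
    have "tube n E (component E (pre w x) x)" "tube n E (component E (pre w z) z)"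
      using tube_component[OF pre_refl] pre_subset[of _ w] w x z by simp_all
    then have "tube n E ?U"
      using z component_refl[OF pre_refl, of x E w] by (intro tube_Un[of _ _ _ _ x x]) auto
    moreover have "?U \<subseteq> pre w z"
      using component_subset[of E] pre_mono[OF w(2), of x z] z by blast
    moreover have "z \<in> ?U" using component_refl[OF pre_refl] by blast
    ultimately show ?thesis using tube_subset_component by blast
  qed
  then have "component E (pre w x) x \<subseteq> down (Psi E w) x"
    unfolding down_def Psi_eq_pre[OF w(2)] w(1) by blast
  ultimately show ?thesis by blast
qed

section \<open>The tubes of a maximal tubing and their tops\<close>

lemma down_refl: "x \<in> down \<X> x"
  by (simp add: down_def)

lemma down_mono: "y \<in> down \<X> x \<Longrightarrow> down \<X> y \<subseteq> down \<X> x"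
  by (auto simp: down_def)

lemma down_subset_member: "T \<in> \<X> \<Longrightarrow> x \<in> T \<Longrightarrow> down \<X> x \<subseteq> T"
  by (auto simp: down_def)

lemma MTub_eq_down:
  assumes "\<X> \<in> MTub n E"
  shows "\<X> = down \<X> ` {1..n}"
proof -
  obtain w where w: "w \<in> permutations_of_set {1..n}" "Psi E w = \<X>" using ex_Psi_eq[OF assms] .
  have "down \<X> ` {1..n} = (\<lambda>x. component E (pre w x) x) ` {1..n}"
    using down_Psi[OF w(1), of _ E] unfolding w(2) by (rule image_cong[OF refl])
  then show ?thesis
    using Psi_eq_pre[OF permD(2)[OF w(1)], of E] permD(1)[OF w(1)] w(2) by simp
qed

lemma down_in_MTub: "\<X> \<in> MTub n E \<Longrightarrow> x \<in> {1..n} \<Longrightarrow> down \<X> x \<in> \<X>"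
  using MTub_eq_down by blast

lemma tube_down: "\<X> \<in> MTub n E \<Longrightarrow> x \<in> {1..n} \<Longrightarrow> tube n E (down \<X> x)"
  using down_in_MTub[of \<X> n E x] by (auto simp: MTub_def tubing_def)

lemma down_antisym:
  assumes "\<X> \<in> MTub n E" "x \<in> {1..n}" "y \<in> {1..n}" "x \<in> down \<X> y" "y \<in> down \<X> x"
  shows "x = y"
proof -
  obtain w where w: "w \<in> permutations_of_set {1..n}" "Psi E w = \<X>" using ex_Psi_eq[OF assms(1)] .
  then have "x \<in> pre w y" "y \<in> pre w x" using assms down_Psi[OF w(1), of _ E] component_subset by blast+
  then show ?thesis using pre_antisym[OF permD(2)[OF w(1)]] by blast
qed

lemma down_inject:
  assumes "\<X> \<in> MTub n E" "x \<in> {1..n}" "y \<in> {1..n}" "down \<X> x = down \<X> y"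
  shows "x = y"
  using down_antisym[OF assms(1-3)] down_refl assms(4) by blast

text \<open>Two tubes that meet or are joined by an edge have a connected union, so compatibility
  forces them to be nested.\<close>

lemma down_comparable:
  assumes X: "\<X> \<in> MTub n E" and xy: "x \<in> {1..n}" "y \<in> {1..n}"
    and u: "u \<in> down \<X> x" and v: "v \<in> down \<X> y" and uv: "u = v \<or> {u, v} \<in> E"
  shows "x \<in> down \<X> y \<or> y \<in> down \<X> x"
proof -
  have "tube n E (down \<X> x \<union> down \<X> y)"
    using tube_down[OF X] xy u v uv by (intro tube_Un) auto
  moreover have "compatible n E (down \<X> x) (down \<X> y)"
    using X down_in_MTub[OF X] xy by (simp add: MTub_def tubing_def)
  ultimately show ?thesis using down_refl[of x \<X>] down_refl[of y \<X>] by (auto simp: compatible_def)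
qed

text \<open>In a word mapped to \<open>\<X>\<close>, take the last letter of \<open>C\<close>: when
  it is read, all of \<open>C\<close> lies in the component it closes. The tube \<open>C\<close> may
  be outside \<open>\<X>\<close>, as for the cut tubes of filled graphs.\<close>

lemma ex_top:
  assumes X: "\<X> \<in> MTub n E" and C: "tube n E C"
  shows "\<exists>t\<in>C. C \<subseteq> down \<X> t"
proof -
  obtain w where w: "w \<in> permutations_of_set {1..n}" "Psi E w = \<X>" using ex_Psi_eq[OF X] .
  have sub: "C \<noteq> {}" "C \<subseteq> {1..n}" "finite C" using tubeD[OF C] by simp_all
  then obtain t where t: "t \<in> C" "C \<subseteq> pre w t"
    using ex_last[OF permD(2)[OF w(1)], of C] permD(1)[OF w(1)] by blast
  then have "C \<subseteq> component E (pre w t) t" using tube_subset_component[OF C] by blast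
  then show ?thesis using t sub down_Psi[OF w(1), of t E] w(2) by blast
qed

lemma tube_top_down:
  assumes X: "\<X> \<in> MTub n E" and x: "x \<in> {1..n}"
  shows "tube_top \<X> (down \<X> x) = x"
  unfolding tube_top_def
proof (rule the_equality)
  show "x \<in> down \<X> x \<and> (\<forall>J\<in>\<X>. J \<subset> down \<X> x \<longrightarrow> x \<notin> J)"
    using down_refl down_subset_member by blast
  fix z assume z: "z \<in> down \<X> x \<and> (\<forall>J\<in>\<X>. J \<subset> down \<X> x \<longrightarrow> z \<notin> J)"
  have zn: "z \<in> {1..n}" using z tube_down[OF X x] by (auto simp: tube_def)
  have "down \<X> z \<subseteq> down \<X> x" using z down_mono by blast
  then have "down \<X> z = down \<X> x" using z down_in_MTub[OF X zn] down_refl[of z \<X>] by blast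
  then show "z = x" using down_inject[OF X zn x] by blast
qed

text \<open>The smaller endpoint as \<open>x\<close> serves the least word of a fibre, the larger
  one the greatest word.\<close>

lemma filled_down_cross:
  assumes "filled E" and X: "\<X> \<in> MTub n E" and "p \<in> {1..n}" "q \<in> {1..n}" "x \<in> {p, q}"
    and "p \<in> down \<X> x" "q \<in> down \<X> x" "p < j" "j < q"
  shows "j \<in> down \<X> x \<or> x \<in> down \<X> j"
proof -
  have x: "x \<in> {1..n}" and j: "j \<in> {1..n}" using assms by auto
  obtain u where "u \<in> down \<X> x" "u = j \<or> {u, j} \<in> E"
    using filled_tube_cross[OF assms(1) tube_down[OF X x]] assms by blast
  then show ?thesis using down_comparable[OF X x j _ down_refl] by blast
qed

subsection \<open>Words related in the weak order\<close>

lemma before_swap: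
  assumes "distinct (u @ [a, b] @ v)"
  shows "before (u @ [b, a] @ v) = before (u @ [a, b] @ v) - {(a, b)} \<union> {(b, a)}"
    and "(a, b) \<in> before (u @ [a, b] @ v)"
proof -
  have *: "before (u @ [c, d] @ v) =
      insert (c, d) (before u \<union> before v \<union> {c, d} \<times> set v \<union> set u \<times> ({c, d} \<union> set v))" for c d
    by (auto simp: before_append)
  have "(a, b) \<notin> before u \<union> before v \<union> {b, a} \<times> set v \<union> set u \<times> ({b, a} \<union> set v)"
    using assms before_subset[of u] before_subset[of v] by auto
  then show "before (u @ [b, a] @ v) = before (u @ [a, b] @ v) - {(a, b)} \<union> {(b, a)}"
    using assms unfolding * by auto
  show "(a, b) \<in> before (u @ [a, b] @ v)" unfolding * by blast
qed

text \<open>If all adjacent pairs of \<open>x\<close> occurred in the same order in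
  \<open>y\<close>, transitivity would extend this to all pairs and the words would
  coincide.\<close>

lemma ex_adjacent_not_before:
  assumes "distinct x" "distinct y" "set x = set y" "x \<noteq> y"
  shows "\<exists>u a b v. x = u @ [a, b] @ v \<and> (b, a) \<in> before y"
proof (rule ccontr)
  assume neg: "\<not> ?thesis"
  have step: "(x ! p, x ! Suc p) \<in> before y" if "Suc p < length x" for p
  proof -
    have "x = take p x @ [x ! p, x ! Suc p] @ drop (Suc (Suc p)) x"
      using that by (simp add: Cons_nth_drop_Suc)
    then have "(x ! Suc p, x ! p) \<notin> before y" using neg by blast
    moreover have "x ! p \<noteq> x ! Suc p" using that assms(1) by (simp add: nth_eq_iff_index_eq)
    moreover have "x ! p \<in> set y" "x ! Suc p \<in> set y" using that assms(3) nth_mem[of p x] nth_mem[of "Suc p" x] by simp_all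
    ultimately show ?thesis using before_total[of "x ! p" y "x ! Suc p"] by blast
  qed
  have chain: "(x ! p, x ! (Suc p + d)) \<in> before y" if "Suc p + d < length x" for p d
    using that
  proof (induction d)
    case 0
    then show ?case using step by simp
  next
    case (Suc d)
    then have "(x ! p, x ! (Suc p + d)) \<in> before y" "(x ! (Suc p + d), x ! Suc (Suc p + d)) \<in> before y"
      using step[of "Suc p + d"] by simp_all
    then show ?case using before_trans[OF assms(2)] by fastforce
  qed
  have sub: "before x \<subseteq> before y"
  proof (rule subrelI)
    fix c d assume "(c, d) \<in> before x"
    then obtain p q where pq: "p < q" "q < length x" "x ! p = c" "x ! q = d" by (auto simp: before_iff_nth)
    then show "(c, d) \<in> before y" using chain[of p "q - Suc p"] by simp
  qed
  have "before y \<subseteq> before x"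
  proof (rule subrelI)
    fix c d assume cd: "(c, d) \<in> before y"
    then have "c \<noteq> d" "c \<in> set x" "d \<in> set x"
      using before_irrefl[OF assms(2)] before_subset[of y] assms(3) by blast+
    then show "(c, d) \<in> before x" using before_total[of c x d] sub before_asym[OF assms(2) cd] by blast
  qed
  with sub show False using before_eq_imp_eq assms by blast
qed

text \<open>Only the initial segments ending at \<open>a\<close> and \<open>b\<close> change. If
  both letters share a component of the longer segment, that component is a tube of both tubings,
  and the tube with top \<open>a\<close> below it is exchanged for one with top \<open>b\<close>.
  Otherwise neither letter affects the component of the other.\<close>

lemma Psi_swap:
  assumes perm: "u @ [a, b] @ v \<in> permutations_of_set {1..n}" and "a < b"
  shows "if b \<in> component E ({a, b} \<union> set u) a
    then (Psi E (u @ [a, b] @ v), Psi E (u @ [b, a] @ v)) \<in> flip n E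
    else Psi E (u @ [a, b] @ v) = Psi E (u @ [b, a] @ v)"
proof -
  define w where "w = u @ [a, b] @ v"
  define w' where "w' = u @ [b, a] @ v"
  have pw: "w \<in> permutations_of_set {1..n}" and pw': "w' \<in> permutations_of_set {1..n}"
    using perm by (auto simp: w_def w'_def permutations_of_set_def)
  note w = permD[OF pw] and w' = permD[OF pw']
  have ab: "a \<in> {1..n}" "b \<in> {1..n}" using w(1) by (auto simp: w_def)
  have bef: "before w' = before w - {(a, b)} \<union> {(b, a)}" "(a, b) \<in> before w"
    using before_swap[of u a b v] w(2) unfolding w_def w'_def by simp_all
  define P where "P = pre w a"
  have "b \<notin> P" using \<open>a < b\<close> bef before_asym[OF w(2)] by (auto simp: P_def pre_def)
  have "a \<in> P" by (simp add: P_def pre_refl)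
  have beq: "(y, b) \<in> before w \<longleftrightarrow> y = a \<or> (y, a) \<in> before w" for y
    using w(2) before_subset[of u] before_subset[of v] unfolding w_def by (auto simp: before_append)
  have "(a, a) \<notin> before w" "(b, a) \<notin> before w"
    using before_irrefl[OF w(2)] before_asym[OF w(2) bef(2)] by blast+
  then have pre_b: "pre w b = insert b P" and pre_a': "pre w' a = insert b P" and pre_b': "pre w' b = insert b (P - {a})"
    unfolding P_def pre_def bef(1) using beq \<open>a < b\<close> by auto
  have pre_eq: "pre w' x = pre w x" if "x \<noteq> a" "x \<noteq> b" for x
    using that by (auto simp: pre_def bef(1))
  define R where "R = (\<lambda>x. component E (pre w x) x) ` ({1..n} - {a, b})"
  have R': "R = (\<lambda>x. component E (pre w' x) x) ` ({1..n} - {a, b})"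
    unfolding R_def using pre_eq by (intro image_cong) auto
  have ins: "{1..n} = insert a (insert b ({1..n} - {a, b}))" using ab by blast
  have X: "Psi E w = {component E P a, component E (insert b P) b} \<union> R"
    unfolding Psi_eq_pre[OF w(2)] w(1) by (subst ins) (simp add: R_def P_def pre_b)
  have Y: "Psi E w' = {component E (insert b P) a, component E (insert b (P - {a})) b} \<union> R"
    unfolding Psi_eq_pre[OF w'(2)] w'(1) by (subst ins) (simp add: R' pre_a' pre_b' )
  have Pn: "insert b P \<subseteq> {1..n}" using pre_subset[of b w] ab w(1) pre_b by simp
  have tA: "tube n E (component E (insert b P) a)" and tB: "tube n E (component E (insert b P) b)"
    using tube_component[OF _ Pn] \<open>a \<in> P\<close> by simp_all
  have "P = insert a (set u)"
    using w(2) before_subset[of u] before_subset[of v] unfolding P_def pre_def w_def by (auto simp: before_append)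
  then have uP: "{a, b} \<union> set u = insert b P" by blast
  show ?thesis
    unfolding w_def[symmetric] w'_def[symmetric] uP
  proof (cases "b \<in> component E (insert b P) a")
    case True
    then have "component E (insert b P) a \<subseteq> component E (insert b P) b"
      by (intro tube_subset_component[OF tA component_subset])
    moreover have "a \<in> component E (insert b P) b"
      using calculation component_refl[of a "insert b P" E] \<open>a \<in> P\<close> by blast
    then have "component E (insert b P) b \<subseteq> component E (insert b P) a"
      by (intro tube_subset_component[OF tB component_subset])
    ultimately have C: "component E (insert b P) b = component E (insert b P) a" by blast
    define I where "I = component E P a"
    define J where "J = component E (insert b (P - {a})) b"
    have I: "I = down (Psi E w) a" using down_Psi[OF pw ab(1)] by (simp add: I_def P_def)
    have J: "J = down (Psi E w') b" using down_Psi[OF pw' ab(2)] by (simp add: J_def pre_b')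
    have MX: "Psi E w \<in> MTub n E" and MY: "Psi E w' \<in> MTub n E" using Psi_in_MTub pw pw' by blast+
    have "b \<notin> I" using \<open>b \<notin> P\<close> component_subset[of E P a] by (auto simp: I_def)
    then have "I \<noteq> J" using J down_refl by blast
    \<comment> \<open>Deleting \<open>I\<close> must not delete the tube of another vertex; tubes
      with different tops are distinct.\<close>
    have "I \<notin> R"
    proof
      assume "I \<in> R"
      then obtain x where "x \<in> {1..n}" "x \<noteq> a" "I = component E (pre w x) x" unfolding R_def by blast
      then show False using down_inject[OF MX ab(1), of x] I down_Psi[OF pw] by simp
    qed
    moreover have "I \<noteq> component E (insert b P) a" using True \<open>b \<notin> I\<close> by blast
    ultimately have "Psi E w' = (Psi E w - {I}) \<union> {J}"
      unfolding X Y C I_def[symmetric] J_def[symmetric] by blast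
    moreover have "tube n E I" "tube n E J" using I J tube_down[OF MX ab(1)] tube_down[OF MY ab(2)] by simp_all
    moreover have "I \<in> Psi E w" using X by (simp add: I_def)
    moreover have "tube_top (Psi E w) I < tube_top (Psi E w') J"
      using tube_top_down[OF MX ab(1)] tube_top_down[OF MY ab(2)] I J \<open>a < b\<close> by simp
    ultimately have "(Psi E w, Psi E w') \<in> flip n E"
      unfolding flip_def using MX MY \<open>I \<noteq> J\<close> by blast
    with True show "if b \<in> component E (insert b P) a then (Psi E w, Psi E w') \<in> flip n E else Psi E w = Psi E w'"
      by simp
  next
    case False
    have "component E (insert b P) a \<subseteq> P" using False component_subset[of E "insert b P" a] by blast
    then have "component E (insert b P) a \<subseteq> component E P a"
      by (rule tube_subset_component[OF tA]) (simp add: component_refl \<open>a \<in> P\<close>)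
    then have 1: "component E P a = component E (insert b P) a"
      using component_mono[of P "insert b P" E a] by blast
    have "a \<notin> component E (insert b P) b"
    proof
      assume "a \<in> component E (insert b P) b"
      then have "component E (insert b P) b \<subseteq> component E (insert b P) a"
        by (intro tube_subset_component[OF tB component_subset])
      then show False using False component_refl[of b "insert b P" E] by blast
    qed
    then have "component E (insert b P) b \<subseteq> insert b (P - {a})"
      using component_subset[of E "insert b P" b] by blast
    then have "component E (insert b P) b \<subseteq> component E (insert b (P - {a})) b"
      by (rule tube_subset_component[OF tB]) (simp add: component_refl)
    then have "component E (insert b P) b = component E (insert b (P - {a})) b"
      using component_mono[of "insert b (P - {a})" "insert b P" E b] by blast
    with 1 have "Psi E w = Psi E w'" unfolding X Y by blast
    with False show "if b \<in> component E (insert b P) a then (Psi E w, Psi E w') \<in> flip n E else Psi E w = Psi E w'"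
      by simp
  qed
qed

text \<open>An adjacent pair of \<open>x\<close> that \<open>y\<close> reverses must be increasing,
  since \<open>y\<close> keeps all inversions of \<open>x\<close>. Swapping it adds exactly one
  inversion and stays below \<open>y\<close>.\<close>

lemma Psi_mono:
  assumes "x \<in> permutations_of_set {1..n}" "y \<in> permutations_of_set {1..n}" "inversions x \<subseteq> inversions y"
  shows "(Psi E x, Psi E y) \<in> (flip n E)\<^sup>*"
  using assms
proof (induction "card (inversions y - inversions x)" arbitrary: x rule: less_induct)
  case less
  note x = permD[OF less.prems(1)] and y = permD[OF less.prems(2)]
  show ?case
  proof (cases "x = y")
    case False
    have "set x = set y" using x y by simp
    from ex_adjacent_not_before[OF x(2) y(2) this False]
    obtain u a b v where x_eq: "x = u @ [a, b] @ v" and ba: "(b, a) \<in> before y" by blast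
    define x' where "x' = u @ [b, a] @ v"
    have px': "x' \<in> permutations_of_set {1..n}"
      using less.prems(1) unfolding x_eq x'_def by (auto simp: permutations_of_set_def)
    have bef: "before x' = before x - {(a, b)} \<union> {(b, a)}" "(a, b) \<in> before x"
      using before_swap[of u a b v] x(2) unfolding x_eq x'_def by simp_all
    have "a \<noteq> b" using bef(2) before_irrefl[OF x(2)] by blast
    have "a < b"
    proof (rule ccontr)
      assume "\<not> a < b"
      then have "(b, a) \<in> inversions x" using \<open>a \<noteq> b\<close> bef(2) by (simp add: in_inversions)
      then have "(a, b) \<in> before y" using less.prems(3) in_inversions[of b a y] by blast
      then show False using before_asym[OF y(2) ba] by blast
    qed
    then have inv': "inversions x' = insert (a, b) (inversions x)"
      unfolding inversions_before bef(1) by auto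
    have ab: "(a, b) \<in> inversions y" "(a, b) \<notin> inversions x"
      using ba \<open>a < b\<close> before_asym[OF x(2) bef(2)] by (simp_all add: in_inversions)
    have "finite (inversions y)"
    proof (rule finite_subset)
      show "inversions y \<subseteq> {1..n} \<times> {1..n}"
        using before_subset[of y] y(1) by (auto simp: inversions_before)
    qed simp
    then have "card (inversions y - inversions x') < card (inversions y - inversions x)"
      using ab inv' by (intro psubset_card_mono) auto
    moreover have "inversions x' \<subseteq> inversions y" using inv' ab less.prems(3) by simp
    ultimately have "(Psi E x', Psi E y) \<in> (flip n E)\<^sup>*"
      using less.hyps[OF _ px' less.prems(2)] by blast
    moreover have "Psi E x = Psi E x' \<or> (Psi E x, Psi E x') \<in> flip n E"
      using Psi_swap[of u a b v n E] less.prems(1) \<open>a < b\<close> unfolding x_eq x'_def by presburger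
    ultimately show ?thesis by (auto intro: converse_rtrancl_into_rtrancl)
  qed simp
qed



subsection \<open>Filled graphs\<close>

text \<open>The inversions of the least, and the non-inversions of the greatest, word mapped to \<open>\<X>\<close>.\<close>

definition tubing_inversions :: "nat \<Rightarrow> nat set set \<Rightarrow> (nat \<times> nat) set" where
  "tubing_inversions n \<X> = {(i, k). i \<in> {1..n} \<and> k \<in> {1..n} \<and> i < k \<and> k \<in> down \<X> i}"

definition tubing_noninversions :: "nat \<Rightarrow> nat set set \<Rightarrow> (nat \<times> nat) set" where
  "tubing_noninversions n \<X> = {(i, k). i \<in> {1..n} \<and> k \<in> {1..n} \<and> i < k \<and> i \<in> down \<X> k}"

text \<open>Transitivity only uses that \<open>down\<close> is a preorder; filledness gives
  cotransitivity. For the greatest word the complement exchanges these two roles.\<close>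

lemma ex_least_preimage:
  assumes "filled E" and X: "\<X> \<in> MTub n E"
  shows "\<exists>w\<in>permutations_of_set {1..n}. inversions w = tubing_inversions n \<X> \<and> Psi E w = \<X>"
proof -
  have "\<exists>w\<in>permutations_of_set {1..n}. inversions w = tubing_inversions n \<X>"
  proof (rule ex_perm_inversions)
    fix i j k assume "(i, k) \<in> tubing_inversions n \<X>" "i < j" "j < k"
    then show "(i, j) \<in> tubing_inversions n \<X> \<or> (j, k) \<in> tubing_inversions n \<X>"
      using filled_down_cross[OF assms, of i k i j] down_refl[of i \<X>] down_mono[of i \<X> j]
      by (auto simp: tubing_inversions_def)
  next
    fix i j k assume "(i, j) \<in> tubing_inversions n \<X>" "(j, k) \<in> tubing_inversions n \<X>"
    then show "(i, k) \<in> tubing_inversions n \<X>"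
      using down_mono[of j \<X> i] by (auto simp: tubing_inversions_def)
  qed (simp add: tubing_inversions_def)
  then obtain w where w: "w \<in> permutations_of_set {1..n}" "inversions w = tubing_inversions n \<X>" by blast
  note pw = permD[OF w(1)]
  have "Psi E w = \<X>"
  proof (rule Psi_eqI[OF X w(1)])
    fix x y assume xy: "x \<in> {1..n}" "y \<in> {1..n}" "x \<in> down \<X> y" "y \<notin> down \<X> x"
    consider "y < x" | "x < y" using xy down_refl by (cases x y rule: linorder_cases) auto
    then show "(x, y) \<in> before w"
    proof cases
      case 1
      then have "(y, x) \<in> inversions w" using xy w by (simp add: tubing_inversions_def)
      then show ?thesis by (simp add: in_inversions)
    next
      case 2
      then have "(x, y) \<notin> inversions w" using xy w by (simp add: tubing_inversions_def)
      then show ?thesis using before_total[of x w y] xy pw 2 by (simp add: in_inversions)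
    qed
  qed
  with w show ?thesis by blast
qed

lemma ex_greatest_preimage:
  assumes "filled E" and X: "\<X> \<in> MTub n E"
  shows "\<exists>w\<in>permutations_of_set {1..n}. Psi E w = \<X> \<and>
    inversions w = {(i, k). i \<in> {1..n} \<and> k \<in> {1..n} \<and> i < k} - tubing_noninversions n \<X>"
    (is "\<exists>w\<in>_. _ \<and> inversions w = ?A")
proof -
  have "\<exists>w\<in>permutations_of_set {1..n}. inversions w = ?A"
  proof (rule ex_perm_inversions)
    fix i j k assume "(i, j) \<in> ?A" "(j, k) \<in> ?A"
    then show "(i, k) \<in> ?A"
      using filled_down_cross[OF assms, of i k k j] down_refl[of k \<X>] down_mono[of k \<X> j]
      by (auto simp: tubing_noninversions_def)
  next
    fix i j k assume "(i, k) \<in> ?A" "i < j" "j < k"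
    then show "(i, j) \<in> ?A \<or> (j, k) \<in> ?A"
      using down_mono[of j \<X> k] by (auto simp: tubing_noninversions_def)
  qed (simp add: tubing_noninversions_def)
  then obtain w where w: "w \<in> permutations_of_set {1..n}" "inversions w = ?A" by blast
  note pw = permD[OF w(1)]
  have "Psi E w = \<X>"
  proof (rule Psi_eqI[OF X w(1)])
    fix x y assume xy: "x \<in> {1..n}" "y \<in> {1..n}" "x \<in> down \<X> y" "y \<notin> down \<X> x"
    consider "y < x" | "x < y" using xy down_refl by (cases x y rule: linorder_cases) auto
    then show "(x, y) \<in> before w"
    proof cases
      case 1
      then have "(y, x) \<in> inversions w" using xy w by (simp add: tubing_noninversions_def)
      then show ?thesis by (simp add: in_inversions)
    next
      case 2
      then have "(x, y) \<notin> inversions w" using xy w by (simp add: tubing_noninversions_def)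
      then show ?thesis using before_total[of x w y] xy pw 2 by (simp add: in_inversions)
    qed
  qed
  with w show ?thesis by blast
qed

text \<open>Cut the component of \<open>k\<close> in \<open>pre y k\<close> to the vertices up to
  \<open>k\<close>; it stays connected and keeps \<open>i\<close>. Its vertices smaller than
  \<open>k\<close> precede \<open>k\<close> in \<open>y\<close>, hence also in \<open>x\<close>,
  which has fewer inversions, so the cut lies in \<open>pre x k\<close>.\<close>

lemma tubing_noninversions_antimono:
  assumes "filled E" and x: "x \<in> permutations_of_set {1..n}" and y: "y \<in> permutations_of_set {1..n}"
    and le: "inversions x \<subseteq> inversions y"
  shows "tubing_noninversions n (Psi E y) \<subseteq> tubing_noninversions n (Psi E x)"
proof (rule subrelI)
  fix i k assume ik: "(i, k) \<in> tubing_noninversions n (Psi E y)"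
  then have i: "i \<in> {1..n}" "k \<in> {1..n}" "i < k" and k: "i \<in> component E (pre y k) k"
    using down_Psi[OF y] by (auto simp: tubing_noninversions_def)
  let ?S = "component E (pre y k) k"
  have S: "tube n E ?S" using tube_component[OF pre_refl] pre_subset[of k y] permD(1)[OF y] i by simp
  have kS: "k \<in> ?S" by (rule component_refl[OF pre_refl])
  have T: "tube n E (?S \<inter> {..k})" using filled_tube_atMost[OF assms(1) S kS] by simp
  have "?S \<inter> {..k} \<subseteq> pre x k"
  proof
    fix s assume s: "s \<in> ?S \<inter> {..k}"
    then have sy: "s \<in> pre y k" using component_subset by blast
    show "s \<in> pre x k"
    proof (cases "s = k")
      case False
      then have "s < k" "(s, k) \<in> before y" using s sy by (auto simp: pre_def)
      then have "(s, k) \<notin> inversions y" using before_asym[OF permD(2)[OF y]] by (auto simp: in_inversions)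
      then have "(k, s) \<notin> before x"
        using le in_inversions[of s k x] \<open>s < k\<close> by blast
      moreover have "s \<in> {1..n}" using s S by (auto simp: tube_def)
      ultimately show ?thesis using before_total[of s x k] permD(1)[OF x] i False by (simp add: pre_def)
    qed (simp add: pre_refl)
  qed
  then have "?S \<inter> {..k} \<subseteq> component E (pre x k) k"
    by (rule tube_subset_component[OF T]) (use kS in simp)
  then show "(i, k) \<in> tubing_noninversions n (Psi E x)"
    using i k down_Psi[OF x i(2)] by (auto simp: tubing_noninversions_def)
qed

text \<open>The flip exchanges a tube with top \<open>a\<close> for one with top \<open>b\<close>,
  where \<open>a < b\<close>, while a tube common to both tubings changes its top from
  \<open>b\<close> to \<open>a\<close>. Only pairs \<open>(b, k)\<close> are in danger, and cutting
  the common tube at \<open>b\<close> rules out their loss.\<close>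

lemma flip_tubing_inversions:
  assumes fil: "filled E" and flip: "(\<X>, \<Y>) \<in> flip n E"
  shows "tubing_inversions n \<X> \<subseteq> tubing_inversions n \<Y>"
proof -
  from flip obtain I J where X: "\<X> \<in> MTub n E" and Y: "\<Y> \<in> MTub n E" and IJ: "I \<noteq> J" "I \<in> \<X>"
    and \<Y>: "\<Y> = (\<X> - {I}) \<union> {J}" and top: "tube_top \<X> I < tube_top \<Y> J"
    unfolding flip_def by blast
  have IY: "I \<notin> \<Y>" using IJ \<Y> by blast
  have up: "T \<in> \<Y>" if "T \<in> \<X>" "T \<noteq> I" for T using that \<Y> by blast
  have dn: "T \<in> \<X>" if "T \<in> \<Y>" "T \<noteq> J" for T using that \<Y> by blast
  obtain a where a: "a \<in> {1..n}" "I = down \<X> a" using IJ(2) MTub_eq_down[OF X] by blast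
  obtain b where b: "b \<in> {1..n}" "J = down \<Y> b" using \<Y> MTub_eq_down[OF Y] by blast
  have "a < b" using top a b tube_top_down[OF X a(1)] tube_top_down[OF Y b(1)] by simp
  have Y_in_X: "down \<Y> x \<in> \<X>" if "x \<in> {1..n}" "x \<noteq> b" for x
    using dn[OF down_in_MTub[OF Y that(1)]] down_inject[OF Y that(1) b(1)] b(2) that(2) by blast
  \<comment> \<open>For \<open>x\<close> other than \<open>b\<close>, the tube
    \<open>down \<Y> x\<close> survives from \<open>\<X>\<close>, so it is closed under
    \<open>down \<X>\<close>.\<close>
  have le: "down \<X> y \<subseteq> down \<Y> x" if "x \<in> {1..n}" "x \<noteq> b" "y \<in> down \<Y> x" for x y
    using down_subset_member[OF Y_in_X that(3)] that by blast
  have "k \<in> down \<Y> i" if i: "i \<in> {1..n}" "i < k" "k \<in> down \<X> i" for i k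
  proof (rule ccontr)
    assume k: "k \<notin> down \<Y> i"
    then have "i = b" using le[OF i(1) _ down_refl] i(3) by blast
    obtain c where c: "c \<in> {1..n}" "down \<Y> a = down \<X> c"
      using Y_in_X[OF a(1)] \<open>a < b\<close> MTub_eq_down[OF X] by blast
    \<comment> \<open>With any other top in \<open>\<X>\<close>, the common tube would have top
      \<open>a\<close> there too, and \<open>I\<close> would have survived the flip.\<close>
    have "c = b"
    proof (rule ccontr)
      assume "c \<noteq> b"
      then have "down \<X> c \<subseteq> down \<Y> c" using le[OF c(1) _ down_refl] by blast
      then have "a \<in> down \<Y> c" "c \<in> down \<Y> a" using c(2) down_refl[of a \<Y>] down_refl[of c \<X>] by blast+
      then have "a = c" using down_antisym[OF Y a(1) c(1)] by blast
      then show False using c(2) a(2) IY down_in_MTub[OF Y a(1)] by simp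
    qed
    \<comment> \<open>The cut drops \<open>a\<close> but keeps \<open>b\<close> and
      \<open>k\<close>. Its top \<open>t\<close> in \<open>\<Y>\<close> is not \<open>b\<close>,
      because \<open>k\<close> is missing from \<open>down \<Y> b\<close>; so
      \<open>down \<Y> t\<close> contains the whole common tube, including \<open>a\<close>. This
      forces \<open>t = a\<close>, although \<open>a\<close> was cut away.\<close>
    let ?C = "down \<Y> a \<inter> {b..}"
    have "b \<in> ?C" using c(2) \<open>c = b\<close> down_refl[of b \<X>] by simp
    then have C: "tube n E ?C" using filled_tube_atLeast[OF fil tube_down[OF Y a(1)], of b b] by simp
    obtain t where t: "t \<in> ?C" "?C \<subseteq> down \<Y> t" using ex_top[OF Y C] by blast
    have tn: "t \<in> {1..n}" using t(1) tubeD(2)[OF C] by blast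
    have "k \<in> ?C" using i c(2) \<open>c = b\<close> \<open>i = b\<close> by simp
    then have "t \<noteq> b" using t(2) k \<open>i = b\<close> by blast
    then have "down \<X> b \<subseteq> down \<Y> t" using le[OF tn] t(2) \<open>b \<in> ?C\<close> by blast
    then have "a \<in> down \<Y> t" using c(2) \<open>c = b\<close> down_refl[of a \<Y>] by blast
    then have "a = t" using down_antisym[OF Y a(1) tn] t(1) by blast
    then show False using t(1) \<open>a < b\<close> by simp
  qed
  then show ?thesis by (auto simp: tubing_inversions_def)
qed

lemma flip_rtrancl_tubing_inversions:
  assumes "filled E" "(\<X>, \<Y>) \<in> (flip n E)\<^sup>*"
  shows "tubing_inversions n \<X> \<subseteq> tubing_inversions n \<Y>"
  using assms(2)
proof induction
  case (step \<Y> \<Z>)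
  then show ?case using flip_tubing_inversions[OF assms(1) step.hyps(2)] by blast
qed simp



section \<open>Lattice quotient maps from adjoints\<close>

lemma (in partial_order) join_eqI:
  assumes "least L s (Upper L {x, y})"
  shows "x \<squnion> y = s"
  unfolding join_def Lattice.sup_def using assms by (rule some_equality) (rule least_unique[OF _ assms])

lemma (in partial_order) meet_eqI:
  assumes "greatest L s (Lower L {x, y})"
  shows "x \<sqinter> y = s"
  unfolding meet_def Lattice.inf_def using assms by (rule some_equality) (rule greatest_unique[OF _ assms])

text \<open>\<open>u\<close> bounds \<open>\<phi> x\<close> and \<open>\<phi> y\<close> from above iff \<open>g u\<close> bounds \<open>x\<close> and \<open>y\<close> from above,
  iff \<open>u\<close> bounds \<open>\<phi> (x \<squnion> y)\<close> from above.\<close>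

lemma lattice_quotient_map_if_adjoints:
  fixes L :: "('a, 'c) gorder_scheme" and L' :: "('b, 'd) gorder_scheme"
  assumes L: "Lattice.lattice L" and L': "partial_order L'"
    and surj: "\<phi> ` carrier L = carrier L'"
    and f: "\<And>X. X \<in> carrier L' \<Longrightarrow> f X \<in> carrier L"
      "\<And>x X. x \<in> carrier L \<Longrightarrow> X \<in> carrier L' \<Longrightarrow> f X \<sqsubseteq>\<^bsub>L\<^esub> x \<longleftrightarrow> X \<sqsubseteq>\<^bsub>L'\<^esub> \<phi> x"
    and g: "\<And>X. X \<in> carrier L' \<Longrightarrow> g X \<in> carrier L"
      "\<And>x X. x \<in> carrier L \<Longrightarrow> X \<in> carrier L' \<Longrightarrow> x \<sqsubseteq>\<^bsub>L\<^esub> g X \<longleftrightarrow> \<phi> x \<sqsubseteq>\<^bsub>L'\<^esub> X"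
  shows "lattice_quotient_map L L' \<phi>"
proof -
  interpret L: Lattice.lattice L by (rule L)
  interpret L': partial_order L' by (rule L')
  have \<phi>: "\<phi> x \<in> carrier L'" if "x \<in> carrier L" for x using that surj by blast
  have lub: "least L' (\<phi> (x \<squnion>\<^bsub>L\<^esub> y)) (Upper L' {\<phi> x, \<phi> y})" if xy: "x \<in> carrier L" "y \<in> carrier L" for x y
  proof -
    have "\<phi> (x \<squnion>\<^bsub>L\<^esub> y) \<sqsubseteq>\<^bsub>L'\<^esub> u \<longleftrightarrow> \<phi> x \<sqsubseteq>\<^bsub>L'\<^esub> u \<and> \<phi> y \<sqsubseteq>\<^bsub>L'\<^esub> u" if u: "u \<in> carrier L'" for u
    proof -
      have "x \<squnion>\<^bsub>L\<^esub> y \<sqsubseteq>\<^bsub>L\<^esub> g u \<longleftrightarrow> x \<sqsubseteq>\<^bsub>L\<^esub> g u \<and> y \<sqsubseteq>\<^bsub>L\<^esub> g u"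
        using L.join_le L.join_left[OF xy] L.join_right[OF xy] L.le_trans L.join_closed xy g(1)[OF u] by metis
      then show ?thesis using g(2) u xy L.join_closed by simp
    qed
    then show ?thesis using \<phi>[OF L.join_closed[OF xy]] \<phi>[OF xy(1)] \<phi>[OF xy(2)]
      by (auto simp: least_def Upper_def)
  qed
  have glb: "greatest L' (\<phi> (x \<sqinter>\<^bsub>L\<^esub> y)) (Lower L' {\<phi> x, \<phi> y})" if xy: "x \<in> carrier L" "y \<in> carrier L" for x y
  proof -
    have "u \<sqsubseteq>\<^bsub>L'\<^esub> \<phi> (x \<sqinter>\<^bsub>L\<^esub> y) \<longleftrightarrow> u \<sqsubseteq>\<^bsub>L'\<^esub> \<phi> x \<and> u \<sqsubseteq>\<^bsub>L'\<^esub> \<phi> y" if u: "u \<in> carrier L'" for u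
    proof -
      have "f u \<sqsubseteq>\<^bsub>L\<^esub> x \<sqinter>\<^bsub>L\<^esub> y \<longleftrightarrow> f u \<sqsubseteq>\<^bsub>L\<^esub> x \<and> f u \<sqsubseteq>\<^bsub>L\<^esub> y"
        using L.meet_le L.meet_left[OF xy] L.meet_right[OF xy] L.le_trans L.meet_closed xy f(1)[OF u] by metis
      then show ?thesis using f(2) u xy L.meet_closed by simp
    qed
    then show ?thesis using \<phi>[OF L.meet_closed[OF xy]] \<phi>[OF xy(1)] \<phi>[OF xy(2)]
      by (auto simp: greatest_def Lower_def)
  qed
  \<comment> \<open>By surjectivity every pair in \<open>L'\<close> is a pair of images, so its
    bounds are images of joins and meets in \<open>L\<close>.\<close>
  have lat': "Lattice.lattice L'"
  proof
    fix X Y assume "X \<in> carrier L'" "Y \<in> carrier L'"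
    then obtain x y where "x \<in> carrier L" "y \<in> carrier L" "X = \<phi> x" "Y = \<phi> y" using surj by blast
    then show "\<exists>s. least L' s (Upper L' {X, Y})" "\<exists>s. greatest L' s (Lower L' {X, Y})"
      using lub glb by blast+
  qed
  have "\<phi> x \<squnion>\<^bsub>L'\<^esub> \<phi> y = \<phi> (x \<squnion>\<^bsub>L\<^esub> y)" if "x \<in> carrier L" "y \<in> carrier L" for x y
    using lub[OF that] by (rule L'.join_eqI)
  moreover have "\<phi> x \<sqinter>\<^bsub>L'\<^esub> \<phi> y = \<phi> (x \<sqinter>\<^bsub>L\<^esub> y)" if "x \<in> carrier L" "y \<in> carrier L" for x y
    using glb[OF that] by (rule L'.meet_eqI)
  ultimately show ?thesis unfolding lattice_quotient_map_def using L lat' surj by simp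
qed

lemma tubing_inversions_Psi_subset:
  assumes "w \<in> permutations_of_set {1..n}"
  shows "tubing_inversions n (Psi E w) \<subseteq> inversions w"
proof (rule subrelI)
  fix i k assume "(i, k) \<in> tubing_inversions n (Psi E w)"
  then have "i < k" "k \<in> component E (pre w i) i"
    using down_Psi[OF assms, of i E] by (simp_all add: tubing_inversions_def)
  then show "(i, k) \<in> inversions w"
    using component_subset[of E "pre w i" i] by (auto simp: in_inversions pre_def)
qed

lemma tubing_noninversions_Psi_disjoint:
  assumes "w \<in> permutations_of_set {1..n}"
  shows "tubing_noninversions n (Psi E w) \<inter> inversions w = {}"
proof -
  have "(i, k) \<notin> inversions w" if "(i, k) \<in> tubing_noninversions n (Psi E w)" for i k
  proof -
    have "i < k" "i \<in> component E (pre w k) k"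
      using that down_Psi[OF assms, of k E] by (simp_all add: tubing_noninversions_def)
    then have "(i, k) \<in> before w" using component_subset[of E "pre w k" k] by (auto simp: pre_def)
    then show ?thesis using before_asym[OF permD(2)[OF assms]] by (simp add: in_inversions)
  qed
  then show ?thesis by auto
qed

text \<open>Antisymmetry is the substantial point: flips in both directions force equal
  \<open>tubing_inversions\<close>, hence equal least words, hence equal tubings.\<close>

lemma partial_order_tubing_poset:
  assumes "filled E"
  shows "partial_order (tubing_poset n E)"
proof -
  have antisym: "\<X> = \<Y>"
    if le: "(\<X>, \<Y>) \<in> (flip n E)\<^sup>*" "(\<Y>, \<X>) \<in> (flip n E)\<^sup>*"
      and M: "\<X> \<in> MTub n E" "\<Y> \<in> MTub n E" for \<X> \<Y>
  proof -
    obtain x where x: "x \<in> permutations_of_set {1..n}" "inversions x = tubing_inversions n \<X>" "Psi E x = \<X>"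
      using ex_least_preimage[OF assms M(1)] by blast
    obtain y where y: "y \<in> permutations_of_set {1..n}" "inversions y = tubing_inversions n \<Y>" "Psi E y = \<Y>"
      using ex_least_preimage[OF assms M(2)] by blast
    have "inversions x = inversions y"
      using flip_rtrancl_tubing_inversions[OF assms le(1)] flip_rtrancl_tubing_inversions[OF assms le(2)] x(2) y(2)
      by simp
    then show ?thesis using inversions_eq_imp_eq[OF x(1) y(1)] x(3) y(3) by simp
  qed
  show ?thesis
    unfolding tubing_poset_def
    by (unfold_locales; simp; (rule antisym | rule rtrancl_trans); assumption)
qed

lemma Psi_image: "Psi E ` permutations_of_set {1..n} = MTub n E"
proof
  show "Psi E ` permutations_of_set {1..n} \<subseteq> MTub n E" using Psi_in_MTub by blast
  show "MTub n E \<subseteq> Psi E ` permutations_of_set {1..n}"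
  proof
    fix \<X> assume "\<X> \<in> MTub n E"
    then show "\<X> \<in> Psi E ` permutations_of_set {1..n}" using ex_Psi_eq by blast
  qed
qed

lemma lattice_quotient_map_if_filled:
  assumes "filled E"
  shows "lattice_quotient_map (weak_order n) (tubing_poset n E) (Psi E)"
proof -
  define f where "f \<X> = (SOME w. w \<in> permutations_of_set {1..n} \<and>
    (inversions w = tubing_inversions n \<X> \<and> Psi E w = \<X>))" for \<X>
  define g where "g \<X> = (SOME w. w \<in> permutations_of_set {1..n} \<and> (Psi E w = \<X> \<and>
    inversions w = {(i, k). i \<in> {1..n} \<and> k \<in> {1..n} \<and> i < k} - tubing_noninversions n \<X>))" for \<X>
  have f': "f \<X> \<in> permutations_of_set {1..n} \<and> (inversions (f \<X>) = tubing_inversions n \<X> \<and> Psi E (f \<X>) = \<X>)"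
    if "\<X> \<in> MTub n E" for \<X>
    unfolding f_def by (rule someI_ex[OF ex_least_preimage[OF assms that, unfolded Bex_def]])
  have g': "g \<X> \<in> permutations_of_set {1..n} \<and> (Psi E (g \<X>) = \<X> \<and>
    inversions (g \<X>) = {(i, k). i \<in> {1..n} \<and> k \<in> {1..n} \<and> i < k} - tubing_noninversions n \<X>)"
    if "\<X> \<in> MTub n E" for \<X>
    unfolding g_def by (rule someI_ex[OF ex_greatest_preimage[OF assms that, unfolded Bex_def]])
  note f = f'[THEN conjunct1] f'[THEN conjunct2, THEN conjunct1] f'[THEN conjunct2, THEN conjunct2]
  note g = g'[THEN conjunct1] g'[THEN conjunct2, THEN conjunct1] g'[THEN conjunct2, THEN conjunct2]
  have f_adj: "inversions (f \<X>) \<subseteq> inversions x \<longleftrightarrow> (\<X>, Psi E x) \<in> (flip n E)\<^sup>*"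
    if "x \<in> permutations_of_set {1..n}" "\<X> \<in> MTub n E" for x \<X>
  proof
    assume "inversions (f \<X>) \<subseteq> inversions x"
    then show "(\<X>, Psi E x) \<in> (flip n E)\<^sup>*" using Psi_mono[of "f \<X>" n x E] f[OF that(2)] that(1) by simp
  next
    assume "(\<X>, Psi E x) \<in> (flip n E)\<^sup>*"
    then have "tubing_inversions n \<X> \<subseteq> tubing_inversions n (Psi E x)"
      by (rule flip_rtrancl_tubing_inversions[OF assms])
    also have "\<dots> \<subseteq> inversions x" by (rule tubing_inversions_Psi_subset[OF that(1)])
    finally show "inversions (f \<X>) \<subseteq> inversions x" using f[OF that(2)] by simp
  qed
  have g_adj: "inversions x \<subseteq> inversions (g \<X>) \<longleftrightarrow> (Psi E x, \<X>) \<in> (flip n E)\<^sup>*"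
    if x: "x \<in> permutations_of_set {1..n}" and \<X>: "\<X> \<in> MTub n E" for x \<X>
  proof
    assume "inversions x \<subseteq> inversions (g \<X>)"
    then show "(Psi E x, \<X>) \<in> (flip n E)\<^sup>*" using Psi_mono[of x n "g \<X>" E] g[OF \<X>] x by simp
  next
    assume le: "(Psi E x, \<X>) \<in> (flip n E)\<^sup>*"
    note fx = f[OF Psi_in_MTub[OF x, of E]] and f\<X> = f[OF \<X>]
    \<comment> \<open>Flips are left behind here: the least words of the two fibres are comparable
      in the weak order, and non-inversions are compared through them.\<close>
    have "inversions (f (Psi E x)) \<subseteq> inversions (f \<X>)"
      using flip_rtrancl_tubing_inversions[OF assms le] fx f\<X> by simp
    then have "tubing_noninversions n \<X> \<subseteq> tubing_noninversions n (Psi E x)"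
      using tubing_noninversions_antimono[OF assms, of "f (Psi E x)" n "f \<X>"] fx f\<X> by simp
    then have "tubing_noninversions n \<X> \<inter> inversions x = {}"
      using tubing_noninversions_Psi_disjoint[OF x, of E] by blast
    moreover have "inversions x \<subseteq> {(i, k). i \<in> {1..n} \<and> k \<in> {1..n} \<and> i < k}"
      using before_subset[of x] unfolding permD(1)[OF x] inversions_before by auto
    ultimately show "inversions x \<subseteq> inversions (g \<X>)" unfolding g(3)[OF \<X>] by blast
  qed
  show ?thesis
  proof (rule lattice_quotient_map_if_adjoints[where f = f and g = g])
    show "Psi E ` carrier (weak_order n) = carrier (tubing_poset n E)"
      using Psi_image by (simp add: weak_order_def tubing_poset_def)
    fix \<X> assume "\<X> \<in> carrier (tubing_poset n E)"
    then have \<X>: "\<X> \<in> MTub n E" by (simp add: tubing_poset_def)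
    show "f \<X> \<in> carrier (weak_order n)" "g \<X> \<in> carrier (weak_order n)"
      using f[OF \<X>] g[OF \<X>] unfolding weak_order_def by simp_all
    fix x assume "x \<in> carrier (weak_order n)"
    then have x: "x \<in> permutations_of_set {1..n}" by (simp add: weak_order_def)
    show "f \<X> \<sqsubseteq>\<^bsub>weak_order n\<^esub> x \<longleftrightarrow> \<X> \<sqsubseteq>\<^bsub>tubing_poset n E\<^esub> Psi E x"
      using f_adj[OF x \<X>] unfolding weak_order_def tubing_poset_def by simp
    show "x \<sqsubseteq>\<^bsub>weak_order n\<^esub> g \<X> \<longleftrightarrow> Psi E x \<sqsubseteq>\<^bsub>tubing_poset n E\<^esub> \<X>"
      using g_adj[OF x \<X>] unfolding weak_order_def tubing_poset_def by simp
  qed (rule lattice_weak_order partial_order_tubing_poset[OF assms])+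
qed

subsection \<open>Necessity of filledness\<close>

lemma weak_order_join_eqI:
  assumes "x \<in> permutations_of_set {1..n}" "y \<in> permutations_of_set {1..n}" "z \<in> permutations_of_set {1..n}"
    and "inversions x \<subseteq> inversions z" "inversions y \<subseteq> inversions z"
    and "\<And>v. v \<in> permutations_of_set {1..n} \<Longrightarrow> inversions x \<subseteq> inversions v \<Longrightarrow> inversions y \<subseteq> inversions v
      \<Longrightarrow> inversions z \<subseteq> inversions v"
  shows "x \<squnion>\<^bsub>weak_order n\<^esub> y = z"
  by (rule partial_order.join_eqI[OF partial_order_weak_order])
     (use assms in \<open>simp add: least_def Upper_def weak_order_def\<close>)

lemma weak_order_meet_eqI:
  assumes "x \<in> permutations_of_set {1..n}" "y \<in> permutations_of_set {1..n}" "z \<in> permutations_of_set {1..n}"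
    and "inversions z \<subseteq> inversions x" "inversions z \<subseteq> inversions y"
    and "\<And>v. v \<in> permutations_of_set {1..n} \<Longrightarrow> inversions v \<subseteq> inversions x \<Longrightarrow> inversions v \<subseteq> inversions y
      \<Longrightarrow> inversions v \<subseteq> inversions z"
  shows "x \<sqinter>\<^bsub>weak_order n\<^esub> y = z"
  by (rule partial_order.meet_eqI[OF partial_order_weak_order])
     (use assms in \<open>simp add: greatest_def Lower_def weak_order_def\<close>)

text \<open>One singleton tube is enough to tell two images apart without computing them.\<close>

lemma singleton_in_Psi:
  assumes "distinct w" "x \<in> set w"
  shows "{x} \<in> Psi E w \<longleftrightarrow> (\<forall>y. (y, x) \<in> before w \<longrightarrow> {x, y} \<notin> E)"
proof
  assume "{x} \<in> Psi E w"
  then obtain z where "{x} = component E (pre w z) z" using Psi_eq_pre[OF assms(1)] by auto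
  then have C: "component E (pre w x) x = {x}" using component_refl[OF pre_refl, of z E w] by force
  show "\<forall>y. (y, x) \<in> before w \<longrightarrow> {x, y} \<notin> E"
  proof (intro allI impI notI)
    fix y assume y: "(y, x) \<in> before w" "{x, y} \<in> E"
    then have "y \<in> component E (pre w x) x"
      using linked_edge[of x "pre w x" y E] by (simp add: component_def pre_def)
    then show False using C y(1) before_irrefl[OF assms(1)] by auto
  qed
next
  assume *: "\<forall>y. (y, x) \<in> before w \<longrightarrow> {x, y} \<notin> E"
  have "component E (pre w x) x \<subseteq> {x}"
  proof
    fix y assume "y \<in> component E (pre w x) x"
    then have "(x, y) \<in> (induced_adj E (pre w x))\<^sup>*" by (simp add: component_def)
    then show "y \<in> {x}"
    proof induction
      case (step y z)
      then show ?case using * by (auto simp: induced_adj_def pre_def)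
    qed simp
  qed
  then have "component E (pre w x) x = {x}" using component_refl[OF pre_refl, of x E w] by blast
  then show "{x} \<in> Psi E w" using Psi_eq_pre[OF assms(1), of E] assms(2) by (metis imageI)
qed

lemma component_pair:
  assumes "{a, b} \<notin> E" "a \<noteq> b"
  shows "b \<notin> component E {a, b} a"
proof
  assume "b \<in> component E {a, b} a"
  then have "(a, b) \<in> (induced_adj E {a, b})\<^sup>*" by (simp add: component_def)
  then have "b = a \<or> (\<exists>c. (c, b) \<in> induced_adj E {a, b} \<and> c \<noteq> b)"
    by (induction) (auto simp: induced_adj_def)
  then show False using assms by (auto simp: induced_adj_def)
qed

lemma Psi_swap_nonadjacent:
  assumes "a # b # v \<in> permutations_of_set {1..n}" "{a, b} \<notin> E" "a < b"
  shows "Psi E (a # b # v) = Psi E (b # a # v)"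
  using Psi_swap[of "[]" a b v n E] component_pair[of a b E] assms by simp

text \<open>On the words that differ only in their first three letters \<open>i < j < k\<close> the weak order is a
  hexagon. If \<open>{i, j}\<close> is not an edge, then \<open>ijk\<close> and \<open>jik\<close> are identified; joining with \<open>ikj\<close>
  identifies \<open>ikj\<close> and \<open>kji\<close>, and the tube \<open>{i}\<close> shows that \<open>{i, k}\<close> is not an edge. The other
  case is dual, with the tube \<open>{k}\<close>.\<close>

lemma filled_if_lattice_quotient_map:
  assumes simple: "simple_graph n E"
    and quot: "lattice_quotient_map (weak_order n) L' (Psi E)"
  shows "filled E"
  unfolding filled_def
proof (intro allI impI)
  fix i j k assume "{i, k} \<in> E \<and> i < j \<and> j < k"
  then have ik: "{i, k} \<in> E" and ij: "i < j" and jk: "j < k" by simp_all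
  have in_n: "i \<in> {1..n}" "k \<in> {1..n}" using simple ik by (auto simp: simple_graph_def)
  then have j_n: "j \<in> {1..n}" using ij jk by simp
  define u where "u = sorted_list_of_set ({1..n} - {i, j, k})"
  have u: "distinct u" "set u = {1..n} - {i, j, k}" by (simp_all add: u_def)
  define P where "P = permutations_of_set {1..n}"
  have perm: "a # b # c # u \<in> P" if "{a, b, c} = {i, j, k}" "distinct [a, b, c]" for a b c
    using that u in_n j_n unfolding P_def permutations_of_set_def by auto
  have perms: "i # j # k # u \<in> P" "j # i # k # u \<in> P" "i # k # j # u \<in> P" "k # j # i # u \<in> P"
    "j # k # i # u \<in> P" "k # i # j # u \<in> P"
    using ij jk by (intro perm; auto)+
  \<comment> \<open>The inversions that involve the common tail \<open>u\<close>; they do not depend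
    on the arrangement of the first three letters.\<close>
  define B where "B = {(p, q). p < q \<and> (q \<in> {i, j, k} \<and> p \<in> set u \<or> (q, p) \<in> before u)}"
  have inv: "inversions (i # j # k # u) = B" "inversions (j # i # k # u) = {(i, j)} \<union> B"
    "inversions (i # k # j # u) = {(j, k)} \<union> B" "inversions (k # j # i # u) = {(i, j), (i, k), (j, k)} \<union> B"
    "inversions (j # k # i # u) = {(i, j), (i, k)} \<union> B" "inversions (k # i # j # u) = {(i, k), (j, k)} \<union> B"
    using ij jk by (auto simp: inversions_before B_def)
  have pres: "Psi E (x \<squnion>\<^bsub>weak_order n\<^esub> y) = Psi E x \<squnion>\<^bsub>L'\<^esub> Psi E y"
    "Psi E (x \<sqinter>\<^bsub>weak_order n\<^esub> y) = Psi E x \<sqinter>\<^bsub>L'\<^esub> Psi E y" if "x \<in> P" "y \<in> P" for x y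
    using quot that unfolding lattice_quotient_map_def weak_order_def P_def by simp_all
  \<comment> \<open>The letter \<open>i\<close> is read first in one word and after its neighbour
    \<open>k\<close> in the other; \<open>k\<close> is treated likewise below.\<close>
  have eq_i: "{i} \<in> Psi E (i # k # j # u)" "{i} \<notin> Psi E (k # j # i # u)"
    using perms ik u ij jk before_subset[of u] unfolding P_def permutations_of_set_def
    by (subst singleton_in_Psi; auto)+
  have eq_k: "{k} \<in> Psi E (k # i # j # u)" "{k} \<notin> Psi E (i # j # k # u)"
    using perms ik u ij jk before_subset[of u] unfolding P_def permutations_of_set_def
    by (subst singleton_in_Psi; auto simp: insert_commute)+
  have "{i, j} \<in> E"
  proof (rule ccontr)
    assume "{i, j} \<notin> E"
    then have eq: "Psi E (i # j # k # u) = Psi E (j # i # k # u)"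
      using Psi_swap_nonadjacent[of i j "k # u" n E] perms ij unfolding P_def by simp
    have 1: "(i # j # k # u) \<squnion>\<^bsub>weak_order n\<^esub> (i # k # j # u) = i # k # j # u"
      using perms unfolding P_def by (intro weak_order_join_eqI) (auto simp: inv)
    have 2: "(j # i # k # u) \<squnion>\<^bsub>weak_order n\<^esub> (i # k # j # u) = k # j # i # u"
    proof (rule weak_order_join_eqI)
      fix v assume v: "v \<in> permutations_of_set {1..n}" "inversions (j # i # k # u) \<subseteq> inversions v"
        "inversions (i # k # j # u) \<subseteq> inversions v"
      then have "(i, k) \<in> inversions v"
        using inversions_trans[OF permD(2)[OF v(1)], of i j k] by (simp add: inv)
      with v show "inversions (k # j # i # u) \<subseteq> inversions v" by (simp add: inv)
    qed (use perms in \<open>auto simp: P_def inv\<close>)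
    have "Psi E (i # k # j # u) = Psi E (k # j # i # u)"
      using pres(1)[of "i # j # k # u" "i # k # j # u"] pres(1)[of "j # i # k # u" "i # k # j # u"] perms
      unfolding 1 2 eq by simp
    with eq_i show False by simp
  qed
  moreover have "{j, k} \<in> E"
  proof (rule ccontr)
    assume "{j, k} \<notin> E"
    then have eq: "Psi E (j # k # i # u) = Psi E (k # j # i # u)"
      using Psi_swap_nonadjacent[of j k "i # u" n E] perms jk unfolding P_def by simp
    have 1: "(k # j # i # u) \<sqinter>\<^bsub>weak_order n\<^esub> (k # i # j # u) = k # i # j # u"
      using perms unfolding P_def by (intro weak_order_meet_eqI) (auto simp: inv)
    have 2: "(j # k # i # u) \<sqinter>\<^bsub>weak_order n\<^esub> (k # i # j # u) = i # j # k # u"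
    proof (rule weak_order_meet_eqI)
      fix v assume v: "v \<in> permutations_of_set {1..n}" "inversions v \<subseteq> inversions (j # k # i # u)"
        "inversions v \<subseteq> inversions (k # i # j # u)"
      have sub: "inversions v \<subseteq> {(i, k)} \<union> B" using v(2,3) ij jk unfolding inv by auto
      \<comment> \<open>A common lower bound can have neither \<open>(i, j)\<close> nor
        \<open>(j, k)\<close> as an inversion, and cotransitivity at \<open>j\<close> then excludes
        \<open>(i, k)\<close>.\<close>
      have "(i, j) \<notin> B" "(j, k) \<notin> B" using u before_subset[of u] by (auto simp: B_def)
      then have "(i, j) \<notin> inversions v" "(j, k) \<notin> inversions v" using sub ij jk by auto
      then have "(i, k) \<notin> inversions v"
        using inversions_cotrans[OF permD(2)[OF v(1)] _ ij jk] permD(1)[OF v(1)] j_n by blast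
      then show "inversions v \<subseteq> inversions (i # j # k # u)" using sub by (auto simp: inv)
    qed (use perms in \<open>auto simp: P_def inv\<close>)
    have "Psi E (k # i # j # u) = Psi E (i # j # k # u)"
      using pres(2)[of "k # j # i # u" "k # i # j # u"] pres(2)[of "j # k # i # u" "k # i # j # u"] perms
      unfolding 1 2 eq by simp
    with eq_k show False by simp
  qed
  ultimately show "{i, j} \<in> E \<and> {j, k} \<in> E" ..
qed

theorem theorem1p1:
  fixes n :: nat and E :: "nat set set"
  assumes "simple_graph n E"
  shows "lattice_quotient_map (weak_order n) (tubing_poset n E) (Psi E) \<longleftrightarrow> filled E"
  using filled_if_lattice_quotient_map[OF assms] lattice_quotient_map_if_filled by blast

end
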